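(* Let $0<\alpha\le\pi/2$. Consider the class of all bounded operators $A$ on complex Hilbert spaces such that $\|A-i\cot\alpha\, I\|\le\csc\alpha$, $\|A+i\cot\alpha\, I\|\le\csc\alpha$, $1\notin\mathrm{Sp}(A)$, and $$(\Phi(A)-\lambda I)^2=0\quad\text{for some }\lambda\in\mathbb C .$$ Then the supremum, over all $A$ in this class and all nonzero polynomials $p\in\mathbb C[z]$, of $$\frac{\|p(A)\|}{\max_{z\in\mathcal L_\alpha}|p(z)|}$$ is exactly $\dfrac{\pi\sin\alpha}{2\alpha}$. Allowing in addition direct sums of such operators with the scalar operator $1$ does not change this constant.
   Context: $\mathcal L_\alpha=\{z\in\mathbb C:|z-i\cot\alpha|\le\csc\alpha\}\cap\{z\in\mathbb C:|z+i\cot\alpha|\le\csc\alpha\}$ is the normalized convex lens (two disks meeting at angle $2\alpha$, vertices $\pm1$). $\Phi(z)=\frac{1+z}{1-z}$ is the Cayley transform, and $\Phi(A)=(I+A)(I-A)^{-1}$ when $1\notin\mathrm{Sp}(A)$, where $\mathrm{Sp}$ denotes the spectrum. *)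

theory Defs
  imports "HOL-Analysis.Analysis" "HOL-Computational_Algebra.Polynomial"
begin

section \<open>Complex Hilbert spaces\<close>

text \<open>The library only has real inner product spaces.  A complex Hilbert space is a complete one
  carrying a compatible complex scalar multiplication and a Hermitian form (linear in the first
  argument) whose real part is the given real inner product.  Positive definiteness of the form and
  \<open>norm x = sqrt (cinner x x)\<close> are inherited from \<open>inner\<close>.\<close>

class chilbert_space = real_inner + banach +
  fixes scaleC :: "complex \<Rightarrow> 'a \<Rightarrow> 'a"  (infixr \<open>*\<^sub>C\<close> 75)
    and cinner :: "'a \<Rightarrow> 'a \<Rightarrow> complex"
  assumes scaleC_add_right: "c *\<^sub>C (x + y) = c *\<^sub>C x + c *\<^sub>C y"
    and scaleC_add_left: "(c + d) *\<^sub>C x = c *\<^sub>C x + d *\<^sub>C x"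
    and scaleC_scaleC: "c *\<^sub>C d *\<^sub>C x = (c * d) *\<^sub>C x"
    and scaleC_of_real: "complex_of_real r *\<^sub>C x = r *\<^sub>R x"
    and cinner_commute: "cinner x y = cnj (cinner y x)"
    and cinner_add_left: "cinner (x + y) z = cinner x z + cinner y z"
    and cinner_scaleC_left: "cinner (c *\<^sub>C x) y = c * cinner x y"
    and Re_cinner: "Re (cinner x y) = inner x y"

instantiation complex :: chilbert_space
begin

definition scaleC_complex :: "complex \<Rightarrow> complex \<Rightarrow> complex"
  where "scaleC_complex c x = c * x"

definition cinner_complex :: "complex \<Rightarrow> complex \<Rightarrow> complex"
  where "cinner_complex x y = x * cnj y"

instance
  by standard
    (auto simp: scaleC_complex_def cinner_complex_def inner_complex_def scaleR_conv_of_real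
      algebra_simps)

end

instantiation vec :: (chilbert_space, finite) chilbert_space
begin

definition scaleC_vec :: "complex \<Rightarrow> 'a ^ 'b \<Rightarrow> 'a ^ 'b"
  where "scaleC_vec c x = (\<chi> i. c *\<^sub>C x $ i)"

definition cinner_vec :: "'a ^ 'b \<Rightarrow> 'a ^ 'b \<Rightarrow> complex"
  where "cinner_vec x y = (\<Sum>i\<in>UNIV. cinner (x $ i) (y $ i))"

instance
proof
  fix x y :: "'a ^ 'b"
  show "cinner x y = cnj (cinner y x)"
    unfolding cinner_vec_def cnj_sum by (intro sum.cong refl cinner_commute)
qed (simp_all add: scaleC_vec_def cinner_vec_def vec_eq_iff scaleC_add_right scaleC_add_left
      scaleC_scaleC scaleC_of_real cinner_add_left cinner_scaleC_left Re_cinner sum.distrib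
      sum_distrib_left inner_vec_def)

end

instantiation prod :: (chilbert_space, chilbert_space) chilbert_space
begin

definition scaleC_prod :: "complex \<Rightarrow> 'a \<times> 'b \<Rightarrow> 'a \<times> 'b"
  where "scaleC_prod c x = (c *\<^sub>C fst x, c *\<^sub>C snd x)"

definition cinner_prod :: "'a \<times> 'b \<Rightarrow> 'a \<times> 'b \<Rightarrow> complex"
  where "cinner_prod x y = cinner (fst x) (fst y) + cinner (snd x) (snd y)"

instance
proof
  fix x y :: "'a \<times> 'b"
  show "cinner x y = cnj (cinner y x)"
    unfolding cinner_prod_def complex_cnj_add by (intro arg_cong2[where f = "(+)"] cinner_commute)
qed (simp_all add: scaleC_prod_def cinner_prod_def prod_eq_iff scaleC_add_right scaleC_add_left
      scaleC_scaleC scaleC_of_real cinner_add_left cinner_scaleC_left Re_cinner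
      inner_prod_def algebra_simps)

end


section \<open>Bounded operators\<close>

definition bounded_clinear :: "('h::chilbert_space \<Rightarrow> 'h) \<Rightarrow> bool"
  where "bounded_clinear A \<longleftrightarrow> bounded_linear A \<and> (\<forall>c x. A (c *\<^sub>C x) = c *\<^sub>C A x)"

definition shift_op :: "('h::chilbert_space \<Rightarrow> 'h) \<Rightarrow> complex \<Rightarrow> 'h \<Rightarrow> 'h"
  where "shift_op A z = (\<lambda>x. A x - z *\<^sub>C x)"

definition Sp :: "('h::chilbert_space \<Rightarrow> 'h) \<Rightarrow> complex set"
  where "Sp A = {z. \<not> (\<exists>B. bounded_clinear B \<and> B \<circ> shift_op A z = id \<and> shift_op A z \<circ> B = id)}"

text \<open>\<open>(I + A) (I - A)\<inverse>\<close>; meaningful only if \<open>1 \<notin> Sp A\<close>.\<close>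

definition cayley :: "('h::chilbert_space \<Rightarrow> 'h) \<Rightarrow> 'h \<Rightarrow> 'h"
  where "cayley A = (\<lambda>x. x + A x) \<circ> inv (\<lambda>x. x - A x)"

definition poly_op :: "complex poly \<Rightarrow> ('h::chilbert_space \<Rightarrow> 'h) \<Rightarrow> 'h \<Rightarrow> 'h"
  where "poly_op p A = (\<lambda>x. \<Sum>i\<le>degree p. coeff p i *\<^sub>C (A ^^ i) x)"


section \<open>The lens and the class of operators\<close>

definition lens :: "real \<Rightarrow> complex set"
  where "lens \<alpha> = {z. cmod (z - \<i> * complex_of_real (cot \<alpha>)) \<le> 1 / sin \<alpha>}
                 \<inter> {z. cmod (z + \<i> * complex_of_real (cot \<alpha>)) \<le> 1 / sin \<alpha>}"

definition lens_class :: "real \<Rightarrow> ('h::chilbert_space \<Rightarrow> 'h) set"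
  where "lens_class \<alpha> = {A. bounded_clinear A
      \<and> onorm (\<lambda>x. A x - (\<i> * complex_of_real (cot \<alpha>)) *\<^sub>C x) \<le> 1 / sin \<alpha>
      \<and> onorm (\<lambda>x. A x + (\<i> * complex_of_real (cot \<alpha>)) *\<^sub>C x) \<le> 1 / sin \<alpha>
      \<and> 1 \<notin> Sp A
      \<and> (\<exists>\<mu>. \<forall>x. (shift_op (cayley A) \<mu> ^^ 2) x = 0)}"

text \<open>The orthogonal direct sum of \<open>A\<close> with the identity of a second Hilbert space.\<close>

definition sum_one :: "('h::chilbert_space \<Rightarrow> 'h) \<Rightarrow> 'h \<times> 'k::chilbert_space \<Rightarrow> 'h \<times> 'k"
  where "sum_one A = map_prod A id"

text \<open>The supremum in the denominator is a maximum, since the lens is compact; it is positive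
  because the lens is infinite.

  HOL cannot quantify over types inside a formula.  That \<open>C\<close> is the supremum over the operators on
  all complex Hilbert spaces is therefore expressed by two facts: \<open>C\<close> bounds \<open>ratios\<close> for an arbitrary
  type of class \<open>chilbert_space\<close>, and \<open>C\<close> is the supremum of \<open>ratios\<close> for one concrete such type.\<close>

definition ratios :: "real \<Rightarrow> ('h::chilbert_space \<Rightarrow> 'h) set \<Rightarrow> real set"
  where "ratios \<alpha> S =
    {onorm (poly_op p A) / (SUP z\<in>lens \<alpha>. cmod (poly p z)) | A p. A \<in> S \<and> p \<noteq> 0}"

end

theory Submission
  imports Defs "HOL-Complex_Analysis.Complex_Analysis"
begin

text \<open>
  Put \<open>\<kappa> = \<pi> / (2 \<alpha>)\<close> and \<open>C = \<kappa> sin \<alpha>\<close>. The condition \<open>(\<Phi>(A) - \<mu>)\<^sup>2 = 0\<close> means \<open>A = a + M\<close> with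
  \<open>a = \<Phi>\<inverse>(\<mu>)\<close> and \<open>M\<^sup>2 = 0\<close> (\<open>lens_class_shifted_square_zero\<close>), so that \<open>p(A) = p(a) + p'(a) M\<close>. Hence
  only three numbers matter: \<open>\<parallel>M\<parallel>\<close>, \<open>\<bar>p(a)\<bar>\<close> and \<open>\<bar>p'(a)\<bar>\<close>.

  On a nonzero space, the norm of \<open>b + N\<close> with \<open>N\<^sup>2 = 0\<close> is that of a 2 by 2 Jordan block: for \<open>K > 0\<close>,
  \<open>\<parallel>b + N\<parallel> \<le> K\<close> holds exactly if \<open>\<parallel>N\<parallel> K \<le> K\<^sup>2 - \<bar>b\<bar>\<^sup>2\<close> and \<open>\<bar>b\<bar> \<le> K\<close>
  (\<open>norm_square_zero_le\<close>, \<open>norm_shifted_square_zero_le\<close>). Applied to the two discs this turns the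
  hypotheses on \<open>A\<close> into \<open>\<parallel>M\<parallel> \<le> lens_gap \<alpha> a\<close>, where the gap is
  \<open>sin \<alpha> (1 - \<bar>a\<bar>\<^sup>2) - 2 cos \<alpha> \<bar>Im a\<bar>\<close>.

  For the upper bound let \<open>\<bar>p\<bar> < 1\<close> on the lens. The Cayley transform and the power \<open>\<kappa>\<close> map the lens to a
  half-plane, so the Schwarz--Pick inequality can be written out; with
  \<open>sin (\<alpha> - \<theta>) \<le> sin \<alpha> cos (\<kappa> \<theta>)\<close> for \<open>0 \<le> \<theta> \<le> \<alpha>\<close> it becomes
  \<open>lens_gap \<alpha> a * \<bar>p'(a)\<bar> \<le> C (1 - \<bar>p(a)\<bar>\<^sup>2)\<close> (\<open>Schwarz_Pick_lens\<close>). Since \<open>C \<ge> 1\<close>, the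
  norm criterion, now for \<open>p(A)\<close>, yields \<open>\<parallel>p(A)\<parallel> \<le> C\<close> (\<open>norm_poly_op_lens_class\<close>). A scalar summand \<open>1\<close> adds only
  the value \<open>p(1)\<close> at a point of the lens.

  Equality is approached at \<open>a = 0\<close>, by the nilpotent 2 by 2 matrix \<open>A\<close> of norm \<open>sin \<alpha>\<close> and by polynomials
  near the conformal map \<open>tanh (\<kappa> artanh z)\<close> of the lens onto the disc, whose derivative at \<open>0\<close> is
  \<open>\<kappa>\<close> (\<open>exists_lens_extremal_poly\<close>, \<open>exists_ratio_greater\<close>).
\<close>

section \<open>Complex scalar multiplication and the Hermitian form\<close>

lemma scaleC_zero_left [simp]: "0 *\<^sub>C (x::'h::chilbert_space) = 0"
  using scaleC_of_real[of 0 x] by simp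

lemma scaleC_one [simp]: "1 *\<^sub>C (x::'h::chilbert_space) = x"
  using scaleC_of_real[of 1 x] by simp

lemma scaleC_minus_left: "(- c) *\<^sub>C (x::'h::chilbert_space) = - (c *\<^sub>C x)"
  using scaleC_add_left[of c "- c" x] by (simp add: eq_neg_iff_add_eq_0 add.commute)

lemma scaleC_diff_left: "(c - d) *\<^sub>C (x::'h::chilbert_space) = c *\<^sub>C x - d *\<^sub>C x"
  using scaleC_add_left[of c "- d" x] by (simp add: scaleC_minus_left)

lemma scaleC_zero_right [simp]: "c *\<^sub>C (0::'h::chilbert_space) = 0"
  using scaleC_add_right[of c 0 "0::'h"] by simp

lemma scaleC_minus_right: "c *\<^sub>C (- x) = - (c *\<^sub>C (x::'h::chilbert_space))"
  using scaleC_add_right[of c x "- x"] by (simp add: eq_neg_iff_add_eq_0 add.commute)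

lemma scaleC_diff_right: "c *\<^sub>C (x - y) = c *\<^sub>C x - c *\<^sub>C (y::'h::chilbert_space)"
  using scaleC_add_right[of c x "- y"] by (simp add: scaleC_minus_right)

lemma cinner_scaleC_right: "cinner x (c *\<^sub>C y) = cnj c * cinner x (y::'h::chilbert_space)"
  by (metis cinner_commute cinner_scaleC_left complex_cnj_mult)

lemma cinner_add_right: "cinner x (y + z) = cinner x y + cinner x (z::'h::chilbert_space)"
  by (metis cinner_commute cinner_add_left complex_cnj_add)

lemma cinner_same: "cinner x x = complex_of_real ((norm (x::'h::chilbert_space))\<^sup>2)"
proof -
  have "Im (cinner x x) = 0"
    using cinner_commute[of x x] by (metis complex_cnj_cancel_iff Reals_cnj_iff complex_is_Real_iff)
  thus ?thesis by (simp add: complex_eq_iff Re_cinner dot_square_norm)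
qed

lemma norm_add_sq_orthogonal:
  assumes "cinner x (y::'h::chilbert_space) = 0"
  shows "(norm (c *\<^sub>C x + d *\<^sub>C y))\<^sup>2 = (cmod c)\<^sup>2 * (norm x)\<^sup>2 + (cmod d)\<^sup>2 * (norm y)\<^sup>2"
proof -
  have "cinner y x = 0" using assms cinner_commute[of y x] by simp
  hence "complex_of_real ((norm (c *\<^sub>C x + d *\<^sub>C y))\<^sup>2)
      = (c * cnj c) * cinner x x + (d * cnj d) * cinner y y"
    using assms unfolding cinner_same[symmetric]
    by (simp add: cinner_add_left cinner_add_right cinner_scaleC_left cinner_scaleC_right)
  also have "\<dots> = complex_of_real ((cmod c)\<^sup>2 * (norm x)\<^sup>2 + (cmod d)\<^sup>2 * (norm y)\<^sup>2)"
    unfolding cinner_same complex_norm_square[symmetric] by simp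
  finally show ?thesis using of_real_eq_iff by blast
qed

lemma norm_scaleC [simp]: "norm (c *\<^sub>C x) = cmod c * norm (x::'h::chilbert_space)"
proof -
  have "(norm (c *\<^sub>C x + 0 *\<^sub>C (0::'h)))\<^sup>2 = (cmod c)\<^sup>2 * (norm x)\<^sup>2 + (cmod 0)\<^sup>2 * (norm (0::'h))\<^sup>2"
    by (rule norm_add_sq_orthogonal) (metis cinner_scaleC_right complex_cnj_zero mult_zero_left scaleC_zero_left)
  thus ?thesis by (simp add: power_mult_distrib[symmetric])
qed

lemma bounded_linear_scaleC: "bounded_linear (\<lambda>x. c *\<^sub>C (x::'h::chilbert_space))"
  by (rule bounded_linear_intro[of _ "cmod c"])
    (auto simp: scaleC_add_right scaleC_scaleC mult_ac simp flip: scaleC_of_real)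

lemma orthogonal_component:
  obtains t where "cinner (x - t *\<^sub>C y) (y::'h::chilbert_space) = 0"
proof (cases "y = 0")
  case True
  thus ?thesis using that[of 0] by (metis cinner_scaleC_right complex_cnj_zero mult_zero_left scaleC_zero_left)
next
  case False
  have "cinner (x - (cinner x y / cinner y y) *\<^sub>C y) y = cinner x y - cinner x y / cinner y y * cinner y y"
    using cinner_add_left[of x "(- (cinner x y / cinner y y)) *\<^sub>C y" y]
    unfolding cinner_scaleC_left by (simp add: scaleC_minus_left)
  also have "\<dots> = 0" using False by (simp add: cinner_same)
  finally show ?thesis using that by blast
qed

section \<open>Norms of Jordan blocks\<close>

text \<open>Every operator of the class on a nonzero space is a scalar plus a square-zero operator, so all norm
  estimates are about operators \<open>a + M\<close> with \<open>M \<circ> M = 0\<close>.\<close>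

definition square_zero :: "('h::chilbert_space \<Rightarrow> 'h) \<Rightarrow> bool" where
  "square_zero M \<longleftrightarrow> bounded_clinear M \<and> (\<forall>x. M (M x) = 0)"

lemma bounded_clinearD:
  assumes "bounded_clinear (A::'h::chilbert_space \<Rightarrow> 'h)"
  shows "bounded_linear A" "A (x + y) = A x + A y" "A (x - y) = A x - A y" "A 0 = 0"
    "A (c *\<^sub>C x) = c *\<^sub>C A x"
  using assms unfolding bounded_clinear_def
  by (auto simp: linear_simps bounded_linear.linear linear_0)

text \<open>The span of \<open>x\<close> and \<open>M x\<close> is invariant under \<open>M\<close>, so norms can be computed in dimension two, and
  subtracting from \<open>x\<close> its component along \<open>M x\<close> does not change \<open>M x\<close>. In the orthogonal basis
  \<open>u, M x\<close> the operator \<open>a + M\<close> is an upper triangular Jordan block. This avoids projections onto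
  the kernel of \<open>M\<close>.\<close>

lemma square_zero_orthogonal:
  assumes "square_zero (M::'h::chilbert_space \<Rightarrow> 'h)"
  obtains u t where "x = u + t *\<^sub>C M x" "cinner u (M x) = 0" "M u = M x"
    "(norm x)\<^sup>2 = (norm u)\<^sup>2 + (cmod t)\<^sup>2 * (norm (M x))\<^sup>2"
proof -
  obtain t where t: "cinner (x - t *\<^sub>C M x) (M x) = 0" by (rule orthogonal_component)
  have M: "bounded_clinear M" "M (M x) = 0" using assms by (auto simp: square_zero_def)
  have "(norm (1 *\<^sub>C (x - t *\<^sub>C M x) + t *\<^sub>C M x))\<^sup>2
      = (cmod 1)\<^sup>2 * (norm (x - t *\<^sub>C M x))\<^sup>2 + (cmod t)\<^sup>2 * (norm (M x))\<^sup>2"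
    by (rule norm_add_sq_orthogonal[OF t])
  thus ?thesis using t M by (intro that[of "x - t *\<^sub>C M x" t]) (auto simp: bounded_clinearD)
qed

lemma norm_shifted_square_zero:
  assumes M: "square_zero (M::'h::chilbert_space \<Rightarrow> 'h)" and u: "cinner u (M x) = 0" "M u = M x"
  shows "(norm (a *\<^sub>C (u + t *\<^sub>C M x) + M (u + t *\<^sub>C M x)))\<^sup>2
      = (cmod a)\<^sup>2 * (norm u)\<^sup>2 + (cmod (a * t + 1))\<^sup>2 * (norm (M x))\<^sup>2"
proof -
  have Mb: "bounded_clinear M" "M (M x) = 0" using M by (auto simp: square_zero_def)
  have "a *\<^sub>C (u + t *\<^sub>C M x) + M (u + t *\<^sub>C M x) = a *\<^sub>C u + (a * t + 1) *\<^sub>C M x"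
    using Mb u by (simp add: bounded_clinearD scaleC_add_right scaleC_add_left scaleC_scaleC)
  thus ?thesis using norm_add_sq_orthogonal[OF u(1)] by simp
qed

text \<open>The two identities record the optimal choice of the test vector in the two estimates that follow:
  a quadratic polynomial is evaluated at its maximum, or written as a square.\<close>

lemma completed_square1:
  fixes A D :: real assumes "D > 0"
  shows "(1 + A * (1/D))\<^sup>2 - (D + A) * A * (1/D)\<^sup>2 = (D + A) / D"
  using assms by (simp add: divide_simps) algebra

lemma completed_square2:
  fixes a D \<tau> :: real assumes "D > 0"
  shows "(D + a\<^sup>2) / D + (D + a\<^sup>2) * \<tau>\<^sup>2 - (a * \<tau> + 1)\<^sup>2 = (a - D * \<tau>)\<^sup>2 / D"
  using assms by (simp add: divide_simps) algebra

text \<open>Testing \<open>\<parallel>a + M\<parallel> \<le> R\<close> on the vectors \<open>u + cnj a * \<tau> * M x\<close> with real \<open>\<tau>\<close> gives a quadratic inequality in \<open>\<tau>\<close>;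
  the best choice is \<open>\<tau> = 1 / (R\<^sup>2 - \<bar>a\<bar>\<^sup>2)\<close>. The resulting bound for \<open>\<parallel>M\<parallel>\<close> is sharp for a Jordan block.\<close>

lemma norm_square_zero_le:
  assumes M: "square_zero (M::'h::chilbert_space \<Rightarrow> 'h)" and R: "R > 0"
    and bd: "\<And>x. norm (a *\<^sub>C x + M x) \<le> R * norm x"
  shows "R * norm (M x) \<le> (R\<^sup>2 - (cmod a)\<^sup>2) * norm x"
proof (cases "M x = 0")
  case True
  have "x = 0 \<or> cmod a \<le> R" using bd[of x] True by (cases "x = 0") auto
  hence "0 \<le> (R\<^sup>2 - (cmod a)\<^sup>2) * norm x" using R by (auto simp: power_mono)
  thus ?thesis using True by simp
next
  case False
  obtain u t where u: "x = u + t *\<^sub>C M x" "cinner u (M x) = 0" "M u = M x"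
    "(norm x)\<^sup>2 = (norm u)\<^sup>2 + (cmod t)\<^sup>2 * (norm (M x))\<^sup>2"
    by (rule square_zero_orthogonal[OF M])
  define D where "D = R\<^sup>2 - (cmod a)\<^sup>2"
  define X where "X = (norm u)\<^sup>2"
  define Y where "Y = (norm (M x))\<^sup>2"
  have Y: "Y > 0" using False by (simp add: Y_def)
  have main: "(cmod a)\<^sup>2 * X + (1 + (cmod a)\<^sup>2 * \<tau>)\<^sup>2 * Y \<le> R\<^sup>2 * (X + (cmod a)\<^sup>2 * \<tau>\<^sup>2 * Y)" for \<tau>
  proof -
    let ?t = "cnj a * of_real \<tau>"
    have "(norm (a *\<^sub>C (u + ?t *\<^sub>C M x) + M (u + ?t *\<^sub>C M x)))\<^sup>2 \<le> (R * norm (u + ?t *\<^sub>C M x))\<^sup>2"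
      by (rule power_mono[OF bd]) simp
    moreover have "a * ?t + 1 = complex_of_real (1 + (cmod a)\<^sup>2 * \<tau>)"
      by (simp add: mult.assoc[symmetric] complex_norm_square[symmetric])
    hence "(cmod (a * ?t + 1))\<^sup>2 = (1 + (cmod a)\<^sup>2 * \<tau>)\<^sup>2" by (metis norm_of_real power2_abs)
    moreover have "(norm (u + ?t *\<^sub>C M x))\<^sup>2 = X + (cmod a)\<^sup>2 * \<tau>\<^sup>2 * Y"
      using norm_add_sq_orthogonal[OF u(2), of 1 ?t]
      by (simp add: X_def Y_def norm_mult power_mult_distrib)
    ultimately show ?thesis
      using norm_shifted_square_zero[OF M u(2,3), of a ?t] by (simp add: X_def Y_def power_mult_distrib)
  qed
  have D: "D > 0"
  proof (rule ccontr)
    \<comment> \<open>For \<open>\<bar>a\<bar> \<ge> R\<close> already \<open>\<tau> = 1\<close> contradicts the hypothesis, since \<open>M x \<noteq> 0\<close>.\<close>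
    assume "\<not> D > 0"
    hence a: "(cmod a)\<^sup>2 \<ge> R\<^sup>2" by (simp add: D_def)
    have "(cmod a)\<^sup>2 * X + (1 + (cmod a)\<^sup>2)\<^sup>2 * Y \<le> R\<^sup>2 * (X + (cmod a)\<^sup>2 * Y)"
      using main[of 1] by simp
    also have "\<dots> \<le> (cmod a)\<^sup>2 * (X + (cmod a)\<^sup>2 * Y)"
      using a Y by (intro mult_right_mono) (auto simp: X_def)
    finally have "(1 + 2 * (cmod a)\<^sup>2) * Y \<le> 0" by (simp add: algebra_simps power2_eq_square)
    thus False using Y by (smt (verit) mult_pos_pos zero_le_power2)
  qed
  have "R\<^sup>2 * Y \<le> D\<^sup>2 * X"
  proof -
    have "((1 + (cmod a)\<^sup>2 * (1 / D))\<^sup>2 - R\<^sup>2 * (cmod a)\<^sup>2 * (1/D)\<^sup>2) * Y \<le> D * X"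
      using main[of "1/D"] by (simp add: D_def algebra_simps)
    moreover have "(1 + (cmod a)\<^sup>2 * (1 / D))\<^sup>2 - R\<^sup>2 * (cmod a)\<^sup>2 * (1/D)\<^sup>2 = R\<^sup>2 / D"
    proof -
      have "R\<^sup>2 = D + (cmod a)\<^sup>2" by (simp add: D_def)
      thus ?thesis using completed_square1[OF D, of "(cmod a)\<^sup>2"] by simp
    qed
    ultimately have "R\<^sup>2 / D * Y \<le> D * X" by simp
    thus ?thesis using D by (simp add: field_simps power2_eq_square)
  qed
  also have "\<dots> \<le> D\<^sup>2 * (norm x)\<^sup>2" using u(4) by (intro mult_left_mono) (auto simp: X_def)
  finally have "(R * norm (M x))\<^sup>2 \<le> (D * norm x)\<^sup>2" by (simp only: Y_def power_mult_distrib)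
  hence "R * norm (M x) \<le> D * norm x" by (rule power2_le_imp_le) (use D in simp)
  thus ?thesis by (simp only: D_def)
qed

text \<open>Conversely, this inequality between \<open>\<parallel>M\<parallel>\<close>, \<open>\<bar>a\<bar>\<close> and \<open>K\<close> suffices. In the orthogonal basis both
  norms are explicit; after \<open>\<parallel>M x\<parallel> \<le> m * \<parallel>u\<parallel>\<close> is inserted, the claim is that a quadratic polynomial
  in \<open>\<bar>t\<bar>\<close> is nonnegative, and that polynomial is a multiple of a square.\<close>

lemma norm_shifted_square_zero_le:
  assumes M: "square_zero (M::'h::chilbert_space \<Rightarrow> 'h)" and K: "K > 0" "cmod a \<le> K"
    and m: "\<And>x. norm (M x) \<le> m * norm x" and mK: "m * K \<le> K\<^sup>2 - (cmod a)\<^sup>2"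
  shows "norm (a *\<^sub>C x + M x) \<le> K * norm x"
proof (cases "M x = 0")
  case True
  thus ?thesis using K by (simp add: mult_right_mono)
next
  case False
  obtain u t where u: "x = u + t *\<^sub>C M x" "cinner u (M x) = 0" "M u = M x"
    "(norm x)\<^sup>2 = (norm u)\<^sup>2 + (cmod t)\<^sup>2 * (norm (M x))\<^sup>2"
    by (rule square_zero_orthogonal[OF M])
  define D where "D = K\<^sup>2 - (cmod a)\<^sup>2"
  define X where "X = (norm u)\<^sup>2"
  define Y where "Y = (norm (M x))\<^sup>2"
  define \<tau> where "\<tau> = cmod t"
  have Y: "Y > 0" using False by (simp add: Y_def)
  have m0: "m > 0" using m[of x] False by (smt (verit) mult_nonpos_nonneg norm_ge_zero zero_less_norm_iff)
  have K0: "K \<ge> 0" using K by simp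
  have "D \<ge> m * K" using mK by (simp add: D_def)
  moreover have "m * K > 0" using m0 K by simp
  ultimately have D: "D > 0" by linarith
  have "Y \<le> (m * norm u)\<^sup>2" using m[of u] u(3) by (simp add: Y_def power_mono)
  hence "K\<^sup>2 * Y \<le> (m * K)\<^sup>2 * X"
    using mult_left_mono[of Y "(m * norm u)\<^sup>2" "K\<^sup>2"] by (simp add: X_def power_mult_distrib mult_ac)
  also have "\<dots> \<le> D\<^sup>2 * X"
    using \<open>D \<ge> m * K\<close> m0 K0 by (intro mult_right_mono power_mono) (auto simp: X_def)
  finally have "K\<^sup>2 / D * Y \<le> D * X" using D by (simp add: field_simps power2_eq_square)
  moreover have "K\<^sup>2 / D + K\<^sup>2 * \<tau>\<^sup>2 - (cmod a * \<tau> + 1)\<^sup>2 = (cmod a - D * \<tau>)\<^sup>2 / D"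
  proof -
    have "K\<^sup>2 = D + (cmod a)\<^sup>2" by (simp add: D_def)
    thus ?thesis using completed_square2[OF D, of "cmod a" \<tau>] by simp
  qed
  hence "(K\<^sup>2 / D + K\<^sup>2 * \<tau>\<^sup>2) \<ge> (cmod a * \<tau> + 1)\<^sup>2"
    using D by (smt (verit) divide_nonneg_pos zero_le_power2)
  hence "(K\<^sup>2 / D + K\<^sup>2 * \<tau>\<^sup>2) * Y \<ge> (cmod a * \<tau> + 1)\<^sup>2 * Y"
    using Y by (intro mult_right_mono) auto
  moreover have "(cmod (a * t + 1))\<^sup>2 * Y \<le> (cmod a * \<tau> + 1)\<^sup>2 * Y"
    using Y norm_triangle_ineq[of "a * t" 1]
    by (intro mult_right_mono power_mono) (auto simp: norm_mult \<tau>_def)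
  ultimately have "(cmod a)\<^sup>2 * X + (cmod (a * t + 1))\<^sup>2 * Y \<le> K\<^sup>2 * (X + \<tau>\<^sup>2 * Y)"
    by (simp add: D_def algebra_simps)
  hence "(norm (a *\<^sub>C x + M x))\<^sup>2 \<le> (K * norm x)\<^sup>2"
    using norm_shifted_square_zero[OF M u(2,3), of a t] u(1,4)
    by (simp add: X_def Y_def \<tau>_def power_mult_distrib)
  thus ?thesis by (rule power2_le_imp_le) (use K0 in simp)
qed

section \<open>Polynomials of an operator\<close>

lemma poly_op_eq_sum:
  assumes "degree p \<le> n"
  shows "poly_op p A x = (\<Sum>i\<le>n. coeff p i *\<^sub>C (A ^^ i) (x::'h::chilbert_space))"
  unfolding poly_op_def
  by (rule sum.mono_neutral_left) (use assms in \<open>auto simp: coeff_eq_0\<close>)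

lemma poly_op_pCons:
  assumes "bounded_clinear (A::'h::chilbert_space \<Rightarrow> 'h)"
  shows "poly_op (pCons c p) A x = c *\<^sub>C x + A (poly_op p A x)"
proof -
  have "A (poly_op p A x) = (\<Sum>i\<le>degree p. coeff p i *\<^sub>C (A ^^ Suc i) x)"
    unfolding poly_op_def using bounded_clinearD[OF assms]
    by (simp add: linear_sum[OF bounded_linear.linear])
  thus ?thesis
    unfolding poly_op_eq_sum[OF degree_pCons_le] sum.atMost_Suc_shift by simp
qed

text \<open>The Taylor expansion of \<open>p\<close> at \<open>a\<close> stops after the linear term because \<open>M\<close> has square zero.\<close>

lemma poly_op_shifted_square_zero:
  assumes M: "square_zero M" and A: "bounded_clinear A"
    and AM: "\<And>x. A x = a *\<^sub>C x + M (x::'h::chilbert_space)"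
  shows "poly_op p A x = poly p a *\<^sub>C x + poly (pderiv p) a *\<^sub>C M x"
proof (induction p)
  case 0
  show ?case by (simp add: poly_op_def)
next
  case (pCons c p)
  have "M (M x) = 0" "bounded_clinear M" using M by (auto simp: square_zero_def)
  thus ?case unfolding poly_op_pCons[OF A] pCons.IH
    by (simp add: AM pderiv_pCons bounded_clinearD scaleC_add_left scaleC_add_right scaleC_scaleC
        mult.commute)
qed

lemma bounded_clinear_shift:
  assumes "bounded_clinear (A::'h::chilbert_space \<Rightarrow> 'h)"
  shows "bounded_clinear (\<lambda>x. A x + c *\<^sub>C x)"
  using assms unfolding bounded_clinear_def
  by (auto intro!: bounded_linear_add bounded_linear_scaleC
      simp: scaleC_add_right scaleC_scaleC mult_ac)

section \<open>Operators of the class as perturbed scalars\<close>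

lemma cayley_apply:
  assumes "1 \<notin> Sp (A::'h::chilbert_space \<Rightarrow> 'h)"
  shows "cayley A (x - A x) = x + A x"
proof -
  obtain B where B: "B \<circ> shift_op A 1 = id" using assms by (auto simp: Sp_def)
  have "inj (\<lambda>x. x - A x)"
  proof (rule injI)
    fix x y assume "x - A x = y - A y"
    hence "shift_op A 1 x = shift_op A 1 y" by (simp add: shift_op_def algebra_simps)
    thus "x = y" using B by (metis comp_apply id_apply)
  qed
  from inv_f_f[OF this, of x] show ?thesis by (simp add: cayley_def)
qed

text \<open>With \<open>J = I - A\<close>, the operator \<open>(\<Phi>(A) - \<mu>) J\<close> is \<open>Q = I + A - \<mu> (I - A)\<close>, which is a polynomial in \<open>A\<close> and
  hence commutes with \<open>J\<close>. So \<open>(\<Phi>(A) - \<mu>)\<^sup>2 = 0\<close> evaluated on the range of \<open>J\<^sup>2\<close> says \<open>Q\<^sup>2 = 0\<close>, and \<open>Q\<close> is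
  \<open>1 + \<mu>\<close> times \<open>A - a\<close> with \<open>a = (\<mu> - 1) / (\<mu> + 1)\<close>. If \<open>\<mu> = -1\<close>, then \<open>Q = 2 I\<close>, which is impossible on a
  nonzero space.\<close>

lemma lens_class_shifted_square_zero:
  assumes A: "A \<in> (lens_class \<alpha> :: ('h::chilbert_space \<Rightarrow> 'h) set)" and nontriv: "(y::'h) \<noteq> 0"
  obtains a M where "square_zero M" "\<And>x. A x = a *\<^sub>C x + M x"
proof -
  obtain \<mu> where Ab: "bounded_clinear A" and spec: "1 \<notin> Sp A"
    and sq: "\<And>x. (shift_op (cayley A) \<mu> ^^ 2) x = 0"
    using A by (auto simp: lens_class_def)
  define Q where "Q = (\<lambda>x. x + A x - \<mu> *\<^sub>C (x - A x))"
  note lin = bounded_clinearD[OF Ab]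
  have shift: "shift_op (cayley A) \<mu> (x - A x) = Q x" for x
    by (simp add: shift_op_def cayley_apply[OF spec] Q_def)
  have commute: "Q (x - A x) = Q x - A (Q x)" for x
    by (simp add: Q_def lin scaleC_diff_right algebra_simps)
  have QQ: "Q (Q x) = 0" for x
  proof -
    let ?J = "\<lambda>x. x - A x"
    have "0 = shift_op (cayley A) \<mu> (shift_op (cayley A) \<mu> (?J (?J x)))"
      using sq[of "?J (?J x)"] by (simp add: numeral_2_eq_2)
    also have "\<dots> = Q (Q x)" unfolding shift commute by (simp add: shift)
    finally show ?thesis by simp
  qed
  have "\<mu> \<noteq> - 1"
  proof
    assume "\<mu> = - 1"
    hence "Q x = x + x" for x by (simp add: Q_def scaleC_minus_left)
    hence "4 *\<^sub>R y = 0" using QQ[of y] by (simp flip: scaleR_2)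
    thus False using nontriv by simp
  qed
  hence mu: "1 + \<mu> \<noteq> 0" by (metis add.commute add_eq_0_iff)
  define a where "a = (\<mu> - 1) / (1 + \<mu>)"
  define M where "M = (\<lambda>x. A x + (- a) *\<^sub>C x)"
  have MQ: "M x = (1 / (1 + \<mu>)) *\<^sub>C Q x" for x
  proof -
    have Q: "Q x = (1 + \<mu>) *\<^sub>C A x + (1 - \<mu>) *\<^sub>C x"
      by (simp add: Q_def scaleC_add_left scaleC_diff_left scaleC_diff_right algebra_simps)
    have "1 / (1 + \<mu>) * (1 - \<mu>) = - a" using mu by (simp add: a_def field_simps)
    thus ?thesis using mu by (simp add: Q M_def scaleC_add_right scaleC_scaleC)
  qed
  have Mb: "bounded_clinear M" unfolding M_def by (rule bounded_clinear_shift[OF Ab])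
  have "M (M x) = 0" for x
  proof -
    have "M (M x) = (1 / (1 + \<mu>)) *\<^sub>C M (Q x)" by (subst MQ) (rule bounded_clinearD(5)[OF Mb])
    also have "M (Q x) = 0" by (subst MQ) (simp only: QQ scaleC_zero_right)
    finally show ?thesis by simp
  qed
  with Mb have "square_zero M" by (simp only: square_zero_def) blast
  moreover have "A x = a *\<^sub>C x + M x" for x by (simp add: M_def scaleC_minus_left)
  ultimately show ?thesis by (rule that)
qed

text \<open>The single quantity that governs both the lens and the operators. For \<open>0 < \<alpha> \<le> \<pi> / 2\<close> it is nonnegative
  exactly on the lens, positive exactly in its interior, and it bounds the nilpotent part of an operator of the
  class at the eigenvalue \<open>a\<close>. For \<open>\<alpha> = \<pi> / 2\<close> it is \<open>1 - \<bar>a\<bar>\<^sup>2\<close>.\<close>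

definition lens_gap :: "real \<Rightarrow> complex \<Rightarrow> real"
  where "lens_gap \<alpha> a = sin \<alpha> * (1 - (cmod a)\<^sup>2) - 2 * cos \<alpha> * \<bar>Im a\<bar>"

lemma sin_cos_lens_angle:
  assumes "0 < \<alpha>" "\<alpha> \<le> pi / 2"
  shows "sin \<alpha> > 0" "cos \<alpha> \<ge> 0"
  using assms by (auto intro!: sin_gt_zero cos_ge_zero)

text \<open>\<open>R\<^sup>2 - \<bar>a - c\<bar>\<^sup>2\<close> for the centre \<open>c = \<plusminus> \<i> cot \<alpha>\<close> and radius \<open>R = 1 / sin \<alpha>\<close> of a disc of the lens; the
  factor \<open>k = \<plusminus> 1\<close> selects the disc. The constant terms combine by \<open>1 / sin\<^sup>2 \<alpha> = 1 + cot\<^sup>2 \<alpha>\<close>.\<close>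

lemma disc_gap:
  assumes "sin \<alpha> > 0" "k\<^sup>2 = 1"
  shows "sin \<alpha> * ((1 / sin \<alpha>)\<^sup>2 - (cmod (a - \<i> * complex_of_real (k * cot \<alpha>)))\<^sup>2)
    = sin \<alpha> * (1 - (cmod a)\<^sup>2) + 2 * cos \<alpha> * (k * Im a)"
proof -
  have csc: "(1 / sin \<alpha>)\<^sup>2 = 1 + (cot \<alpha>)\<^sup>2"
    using assms sin_cos_squared_add[of \<alpha>] by (simp add: cot_def field_simps)
  have "(cmod (a - \<i> * complex_of_real (k * cot \<alpha>)))\<^sup>2
      = (cmod a)\<^sup>2 - 2 * cot \<alpha> * (k * Im a) + k\<^sup>2 * (cot \<alpha>)\<^sup>2"
    unfolding cmod_power2 by (simp add: power2_eq_square algebra_simps)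
  hence "(1 / sin \<alpha>)\<^sup>2 - (cmod (a - \<i> * complex_of_real (k * cot \<alpha>)))\<^sup>2
      = 1 - (cmod a)\<^sup>2 + 2 * cot \<alpha> * (k * Im a)" using csc assms(2) by simp
  thus ?thesis using assms(1) by (simp only:) (simp add: cot_def field_simps)
qed

text \<open>The two terms are the right-hand sides of the preceding lemma for \<open>k = 1\<close> and \<open>k = - 1\<close>, written
  with the factor \<open>k\<close> so that the two discs can be treated together.\<close>

lemma lens_gap_eq_min:
  assumes "cos \<alpha> \<ge> 0"
  shows "lens_gap \<alpha> a = min (sin \<alpha> * (1 - (cmod a)\<^sup>2) + 2 * cos \<alpha> * (1 * Im a))
                             (sin \<alpha> * (1 - (cmod a)\<^sup>2) + 2 * cos \<alpha> * (- 1 * Im a))"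
proof -
  have "cos \<alpha> * \<bar>Im a\<bar> = \<bar>cos \<alpha> * Im a\<bar>" using assms by (simp add: abs_mult)
  moreover have "X - 2 * \<bar>y\<bar> = min (X + 2 * y) (X - 2 * y)" for X y :: real by linarith
  ultimately show ?thesis by (simp add: lens_gap_def mult.assoc)
qed

lemma mem_lens_iff:
  assumes "0 < \<alpha>" "\<alpha> \<le> pi / 2"
  shows "a \<in> lens \<alpha> \<longleftrightarrow> lens_gap \<alpha> a \<ge> 0"
proof -
  note sc = sin_cos_lens_angle[OF assms]
  have disc: "cmod (a - \<i> * complex_of_real (k * cot \<alpha>)) \<le> 1 / sin \<alpha>
      \<longleftrightarrow> 0 \<le> sin \<alpha> * (1 - (cmod a)\<^sup>2) + 2 * cos \<alpha> * (k * Im a)" if "k\<^sup>2 = 1" for k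
  proof -
    have "cmod (a - \<i> * complex_of_real (k * cot \<alpha>)) \<le> 1 / sin \<alpha>
      \<longleftrightarrow> (cmod (a - \<i> * complex_of_real (k * cot \<alpha>)))\<^sup>2 \<le> (1 / sin \<alpha>)\<^sup>2"
      using sc by (subst abs_le_square_iff[symmetric]) auto
    also have "\<dots> \<longleftrightarrow> 0 \<le> sin \<alpha> * ((1 / sin \<alpha>)\<^sup>2 - (cmod (a - \<i> * complex_of_real (k * cot \<alpha>)))\<^sup>2)"
      using sc by (subst zero_le_mult_iff) auto
    finally show ?thesis unfolding disc_gap[OF sc(1) that] .
  qed
  show ?thesis
    using disc[of 1] disc[of "- 1"] by (simp add: lens_def lens_gap_eq_min[OF sc(2)])
qed

text \<open>Each of the two disc conditions bounds \<open>\<parallel>M\<parallel>\<close> by \<open>(R\<^sup>2 - \<bar>a - c\<bar>\<^sup>2) / R\<close>, and \<open>lens_gap\<close> is the smaller of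
  the two bounds.\<close>

lemma lens_class_nilpotent_bound:
  assumes \<alpha>: "0 < \<alpha>" "\<alpha> \<le> pi / 2" and A: "A \<in> (lens_class \<alpha> :: ('h::chilbert_space \<Rightarrow> 'h) set)"
    and M: "square_zero M" and AM: "\<And>x. A x = a *\<^sub>C x + M x"
  shows "norm (M x) \<le> lens_gap \<alpha> a * norm x"
proof -
  note sc = sin_cos_lens_angle[OF \<alpha>]
  have Ab: "bounded_clinear A" using A by (simp add: lens_class_def)
  have disc: "norm (M x) \<le> (sin \<alpha> * (1 - (cmod a)\<^sup>2) + 2 * cos \<alpha> * (k * Im a)) * norm x"
    if k: "k\<^sup>2 = 1"
      and on: "onorm (\<lambda>x. A x + (- (\<i> * complex_of_real (k * cot \<alpha>))) *\<^sub>C x) \<le> 1 / sin \<alpha>" for k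
  proof -
    let ?c = "- (\<i> * complex_of_real (k * cot \<alpha>))"
    let ?b = "a - \<i> * complex_of_real (k * cot \<alpha>)"
    have "norm (?b *\<^sub>C x + M x) \<le> 1 / sin \<alpha> * norm x" for x
    proof -
      have "?b *\<^sub>C x + M x = A x + ?c *\<^sub>C x" by (simp add: AM scaleC_diff_left scaleC_minus_left)
      also have "norm \<dots> \<le> onorm (\<lambda>x. A x + ?c *\<^sub>C x) * norm x"
        by (rule onorm) (rule bounded_clinearD(1)[OF bounded_clinear_shift[OF Ab]])
      also have "\<dots> \<le> 1 / sin \<alpha> * norm x" using on by (rule mult_right_mono) simp
      finally show ?thesis .
    qed
    from norm_square_zero_le[OF M _ this, of x] sc
    have "1 / sin \<alpha> * norm (M x) \<le> ((1 / sin \<alpha>)\<^sup>2 - (cmod ?b)\<^sup>2) * norm x" by simp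
    hence "sin \<alpha> * (1 / sin \<alpha> * norm (M x)) \<le> sin \<alpha> * (((1 / sin \<alpha>)\<^sup>2 - (cmod ?b)\<^sup>2) * norm x)"
      using sc by (intro mult_left_mono) auto
    thus ?thesis unfolding disc_gap[OF sc(1) k, symmetric] using sc by (simp add: mult.assoc)
  qed
  have "onorm (\<lambda>x. A x + (- (\<i> * complex_of_real (1 * cot \<alpha>))) *\<^sub>C x) \<le> 1 / sin \<alpha>"
       "onorm (\<lambda>x. A x + (- (\<i> * complex_of_real (- 1 * cot \<alpha>))) *\<^sub>C x) \<le> 1 / sin \<alpha>"
    using A by (simp_all add: lens_class_def scaleC_minus_left)
  from disc[OF _ this(1)] disc[OF _ this(2)] show ?thesis
    unfolding lens_gap_eq_min[OF sc(2)] min_def by auto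
qed

section \<open>The Schwarz--Pick inequality for the lens\<close>

text \<open>With \<open>\<kappa> = \<pi> / (2 \<alpha>) \<ge> 1\<close> the quotient \<open>sin u / sin (\<kappa> u)\<close> is nondecreasing on \<open>(0, \<alpha>]\<close>, and its value at \<open>\<alpha>\<close> is
  \<open>sin \<alpha>\<close>. The numerator of its derivative vanishes at \<open>0\<close> and has derivative
  \<open>(\<kappa>\<^sup>2 - 1) sin u sin (\<kappa> u) \<ge> 0\<close>. Because of this inequality no eigenvalue \<open>a\<close> is
  worse than one with \<open>\<Phi>(a)\<close> on the positive real axis.\<close>

lemma sin_le_sin_mult_sin:
  assumes \<alpha>: "0 < \<alpha>" "\<alpha> \<le> pi / 2" and u: "0 \<le> u" "u \<le> \<alpha>"
  shows "sin u \<le> sin \<alpha> * sin (pi / (2 * \<alpha>) * u)"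
proof (cases "u = 0")
  case False
  define \<kappa> where "\<kappa> = pi / (2 * \<alpha>)"
  have \<kappa>: "\<kappa> \<ge> 1" using \<alpha> by (simp add: \<kappa>_def field_simps)
  have \<kappa>t: "\<kappa> * t \<le> pi / 2" if "t \<le> \<alpha>" for t
    using mult_left_mono[OF that, of \<kappa>] \<kappa> \<alpha> by (simp add: \<kappa>_def)
  have num: "0 \<le> cos t * sin (\<kappa> * t) - \<kappa> * (sin t * cos (\<kappa> * t))" if t: "0 \<le> t" "t \<le> \<alpha>" for t
  proof -
    let ?N = "\<lambda>t. cos t * sin (\<kappa> * t) - \<kappa> * (sin t * cos (\<kappa> * t))"
    have "?N 0 \<le> ?N t"
    proof (rule DERIV_nonneg_imp_nondecreasing[OF t(1)])
      fix v assume v: "0 \<le> v" "v \<le> t"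
      have "\<kappa>\<^sup>2 \<ge> 1" using \<kappa> by simp
      moreover have "sin v \<ge> 0" using v t \<alpha> by (intro sin_ge_zero) auto
      moreover have "sin (\<kappa> * v) \<ge> 0" using v t \<alpha> \<kappa> \<kappa>t[of v] by (intro sin_ge_zero) auto
      ultimately have "(\<kappa>\<^sup>2 - 1) * (sin v * sin (\<kappa> * v)) \<ge> 0" by simp
      moreover have "(?N has_real_derivative (\<kappa>\<^sup>2 - 1) * (sin v * sin (\<kappa> * v))) (at v)"
        by (auto intro!: derivative_eq_intros simp: algebra_simps power2_eq_square)
      ultimately show "\<exists>y. (?N has_real_derivative y) (at v) \<and> y \<ge> 0" by blast
    qed
    thus ?thesis by simp
  qed
  have pos: "sin (\<kappa> * t) > 0" if "u \<le> t" "t \<le> \<alpha>" for t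
  proof (rule sin_gt_zero)
    show "\<kappa> * t > 0" using that u False \<kappa> by simp
    show "\<kappa> * t < pi" using \<kappa>t[OF that(2)] pi_gt_zero by linarith
  qed
  have "sin u / sin (\<kappa> * u) \<le> sin \<alpha> / sin (\<kappa> * \<alpha>)"
  proof (rule DERIV_nonneg_imp_nondecreasing[OF u(2)])
    fix t assume t: "u \<le> t" "t \<le> \<alpha>"
    let ?D = "(cos t * sin (\<kappa> * t) - \<kappa> * (sin t * cos (\<kappa> * t))) / (sin (\<kappa> * t))\<^sup>2"
    have "((\<lambda>t. sin t / sin (\<kappa> * t)) has_real_derivative ?D) (at t)"
      using pos[OF t] by (auto intro!: derivative_eq_intros simp: power2_eq_square)
    moreover have "?D \<ge> 0" using num[of t] t u by simp
    ultimately show "\<exists>y. ((\<lambda>t. sin t / sin (\<kappa> * t)) has_real_derivative y) (at t) \<and> y \<ge> 0" by blast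
  qed
  moreover have "\<kappa> * \<alpha> = pi / 2" using \<alpha> by (simp add: \<kappa>_def)
  ultimately have "sin u \<le> sin \<alpha> * sin (\<kappa> * u)" using pos[of u] u by (simp add: divide_le_eq)
  thus ?thesis by (simp add: \<kappa>_def)
qed simp

text \<open>The Schwarz lemma after moving \<open>f 0\<close> to the origin by a Moebius map.\<close>

lemma Schwarz_Pick_at_0:
  assumes f: "f holomorphic_on ball 0 1" and f1: "\<And>z. cmod z < 1 \<Longrightarrow> cmod (f z) < 1"
  shows "cmod (deriv f 0) \<le> 1 - (cmod (f 0))\<^sup>2"
proof -
  define b where "b = f 0"
  define g where "g = Moebius_function 0 b \<circ> f"
  have b: "cmod b < 1" using f1 by (simp add: b_def)
  hence b2: "1 - (cmod b)\<^sup>2 > 0" by (simp add: power_less_one_iff abs_square_less_1)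
  have bb: "1 - cnj b * b = of_real (1 - (cmod b)\<^sup>2)"
    unfolding of_real_diff of_real_1 complex_norm_square by (simp add: mult.commute)
  have "g holomorphic_on ball 0 1" unfolding g_def
    by (rule holomorphic_on_compose_gen[OF f Moebius_function_holomorphic[OF b]]) (auto simp: f1)
  moreover have "g 0 = 0" by (simp add: g_def b_def Moebius_function_eq_zero)
  moreover have "cmod (g z) < 1" if "cmod z < 1" for z
    using Moebius_function_norm_lt_1[OF b f1[OF that]] by (simp add: g_def)
  ultimately have "cmod (deriv g 0) \<le> 1" by (rule Schwarz_Lemma(2)[where \<xi> = 0]) simp_all
  moreover have "(g has_field_derivative deriv f 0 / of_real (1 - (cmod b)\<^sup>2)) (at 0)"
  proof -
    have "(f has_field_derivative deriv f 0) (at 0)"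
      using f holomorphic_derivI[of f "ball 0 1" 0] by simp
    moreover have "1 - cnj b * b \<noteq> 0" unfolding bb using b2 of_real_eq_0_iff by (metis less_irrefl)
    ultimately have "((\<lambda>z. (f z - b) / (1 - cnj b * f z)) has_field_derivative
        deriv f 0 / (1 - cnj b * b)) (at 0)"
      by (auto intro!: derivative_eq_intros simp: b_def[symmetric])
    thus ?thesis unfolding bb by (simp add: g_def comp_def Moebius_function_simple)
  qed
  hence "deriv g 0 = deriv f 0 / of_real (1 - (cmod b)\<^sup>2)" by (rule DERIV_imp_deriv)
  ultimately show ?thesis using b2 by (simp add: b_def norm_divide divide_le_eq del: of_real_diff)
qed

text \<open>In polar coordinates \<open>\<zeta> = r exp(\<i> \<theta>)\<close>, for \<open>cos \<alpha> \<ge> 0\<close> this is the smaller of the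
  signed distances of \<open>\<zeta>\<close> to the two lines that bound the sector \<open>\<bar>arg\<bar> \<le> \<alpha>\<close>, positive on its side.\<close>

lemma sector_gap:
  assumes "\<bar>\<theta>\<bar> \<le> pi" "r \<ge> 0"
  shows "sin \<alpha> * Re (of_real r * cis \<theta>) - cos \<alpha> * \<bar>Im (of_real r * cis \<theta>)\<bar> = r * sin (\<alpha> - \<bar>\<theta>\<bar>)"
proof -
  have "\<bar>sin \<theta>\<bar> = sin \<bar>\<theta>\<bar>"
    using assms sin_ge_zero[of "\<bar>\<theta>\<bar>"] by (cases "\<theta> \<ge> 0") auto
  moreover have "cos \<theta> = cos \<bar>\<theta>\<bar>" by simp
  ultimately show ?thesis using assms(2) by (simp add: abs_mult sin_diff algebra_simps)
qed

text \<open>The Cayley transform carries the lens to the sector \<open>\<bar>arg\<bar> \<le> \<alpha>\<close>: up to a positive factor, the gap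
  of a point of the lens is the expression of the preceding lemma for its image \<open>\<zeta>\<close>.\<close>

lemma lens_gap_inverse_cayley:
  assumes "\<zeta> \<noteq> - 1"
  shows "lens_gap \<alpha> ((\<zeta> - 1) / (\<zeta> + 1))
    = 4 * (sin \<alpha> * Re \<zeta> - cos \<alpha> * \<bar>Im \<zeta>\<bar>) / (cmod (\<zeta> + 1))\<^sup>2"
proof -
  define N where "N = (cmod (\<zeta> + 1))\<^sup>2"
  have N: "N > 0" using assms by (simp add: N_def eq_neg_iff_add_eq_0)
  have "1 - (cmod ((\<zeta> - 1) / (\<zeta> + 1)))\<^sup>2 = 4 * Re \<zeta> / N"
  proof -
    have "(cmod (\<zeta> - 1))\<^sup>2 = N - 4 * Re \<zeta>"
      unfolding N_def cmod_power2 by (simp add: power2_eq_square algebra_simps)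
    moreover have "(cmod ((\<zeta> - 1) / (\<zeta> + 1)))\<^sup>2 = (cmod (\<zeta> - 1))\<^sup>2 / N"
      by (simp only: norm_divide power_divide N_def)
    ultimately show ?thesis using N by (simp add: field_simps)
  qed
  moreover have "Im ((\<zeta> - 1) / (\<zeta> + 1)) = 2 * Im \<zeta> / N"
    unfolding N_def cmod_power2 Im_divide by (simp add: algebra_simps)
  ultimately show ?thesis using N
    by (simp add: lens_gap_def N_def[symmetric] abs_mult abs_divide diff_divide_distrib right_diff_distrib)
qed

lemma inverse_cayley_cayley:
  fixes a :: complex
  assumes "a \<noteq> 1" and "\<zeta> = (1 + a) / (1 - a)"
  shows "\<zeta> \<noteq> - 1" "(\<zeta> - 1) / (\<zeta> + 1) = a"
proof -
  have "1 - a \<noteq> 0" using assms(1) by simp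
  hence *: "\<zeta> + 1 = 2 / (1 - a)" "\<zeta> - 1 = 2 * a / (1 - a)" using assms(2) by (simp_all add: field_simps)
  show "(\<zeta> - 1) / (\<zeta> + 1) = a" unfolding * using \<open>1 - a \<noteq> 0\<close> by simp
  show "\<zeta> \<noteq> - 1"
  proof
    assume "\<zeta> = - 1"
    with *(1) \<open>1 - a \<noteq> 0\<close> show False by simp
  qed
qed

text \<open>For \<open>Re \<omega> > 0\<close> this Moebius map takes the unit disc onto the right half-plane and \<open>0\<close> to \<open>\<omega>\<close>.\<close>

lemma Re_disc_to_half_plane_pos:
  assumes "Re \<omega> > 0" "cmod u < 1"
  shows "Re ((\<omega> + cnj \<omega> * u) / (1 - u)) > 0"
proof -
  have "1 - u \<noteq> 0" using assms(2) by auto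
  have "(cmod u)\<^sup>2 < 1" using assms(2) by (simp add: abs_square_less_1)
  hence u: "(Re u)\<^sup>2 + (Im u)\<^sup>2 < 1" by (simp add: cmod_power2)
  have "Re ((\<omega> + cnj \<omega> * u) * cnj (1 - u)) = Re \<omega> * (1 - ((Re u)\<^sup>2 + (Im u)\<^sup>2))"
    by (simp add: algebra_simps power2_eq_square)
  moreover have "(\<omega> + cnj \<omega> * u) / (1 - u)
      = (\<omega> + cnj \<omega> * u) * cnj (1 - u) / of_real ((cmod (1 - u))\<^sup>2)"
    by (rule complex_div_cnj)
  ultimately have "Re ((\<omega> + cnj \<omega> * u) / (1 - u))
      = Re \<omega> * (1 - ((Re u)\<^sup>2 + (Im u)\<^sup>2)) / (cmod (1 - u))\<^sup>2"
    by (simp only: Re_divide_of_real)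
  thus ?thesis using assms(1) u \<open>1 - u \<noteq> 0\<close> by simp
qed

corollary Re_cayley_pos:
  assumes "cmod u < 1"
  shows "Re ((1 + u) / (1 - u)) > 0"
  using Re_disc_to_half_plane_pos[of 1 u] assms by simp

text \<open>The conformal map of the disc onto the open lens with \<open>0 \<mapsto> a\<close>: map the disc to the right half-plane,
  open the half-plane to the sector \<open>\<bar>arg\<bar> < \<alpha>\<close> by the power \<open>1 / \<kappa>\<close>, scale, and apply the inverse Cayley
  transform. If \<open>\<Phi>(a) = \<rho> exp(\<i> \<theta>)\<close>, the starting point in the half-plane has to be \<open>exp(\<i> \<kappa> \<theta>)\<close>. The chain rule
  turns the comparison of \<open>lens_gap \<alpha> a\<close> with the derivative at \<open>0\<close> into
  \<open>sin (\<alpha> - \<bar>\<theta>\<bar>) \<le> sin \<alpha> cos (\<kappa> \<theta>)\<close>.\<close>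

lemma lens_interior_disc_map:
  assumes \<alpha>: "0 < \<alpha>" "\<alpha> \<le> pi / 2" and a: "lens_gap \<alpha> a > 0"
  obtains \<psi> where "\<psi> holomorphic_on ball 0 1" "\<psi> 0 = a"
    "\<And>u. cmod u < 1 \<Longrightarrow> lens_gap \<alpha> (\<psi> u) > 0"
    "lens_gap \<alpha> a \<le> pi * sin \<alpha> / (2 * \<alpha>) * cmod (deriv \<psi> 0)"
proof -
  note sc = sin_cos_lens_angle[OF \<alpha>]
  define \<kappa> where "\<kappa> = pi / (2 * \<alpha>)"
  have \<kappa>: "\<kappa> > 0" "\<kappa> * \<alpha> = pi / 2" using \<alpha> by (simp_all add: \<kappa>_def)
  define \<zeta> where "\<zeta> = (1 + a) / (1 - a)"
  have "a \<noteq> 1" using a by (auto simp: lens_gap_def)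
  note \<zeta> = inverse_cayley_cayley[OF this \<zeta>_def]
  define \<rho> where "\<rho> = cmod \<zeta>"
  define \<theta> where "\<theta> = Arg \<zeta>"
  have polar: "\<zeta> = of_real \<rho> * cis \<theta>" using rcis_cmod_Arg[of \<zeta>] by (simp add: \<rho>_def \<theta>_def rcis_def)
  have \<theta>pi: "\<bar>\<theta>\<bar> \<le> pi" using Arg_bounded[of \<zeta>] by (auto simp: \<theta>_def)
  have \<rho>0: "\<rho> \<ge> 0" by (simp add: \<rho>_def)
  define N where "N = (cmod (\<zeta> + 1))\<^sup>2"
  have N: "N > 0" using \<zeta>(1) by (simp add: N_def eq_neg_iff_add_eq_0)
  have gap: "lens_gap \<alpha> a = 4 * (\<rho> * sin (\<alpha> - \<bar>\<theta>\<bar>)) / N"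
    using lens_gap_inverse_cayley[OF \<zeta>(1), of \<alpha>] sector_gap[OF \<theta>pi \<rho>0, of \<alpha>]
    unfolding \<zeta>(2) by (simp add: polar N_def)
  have pos: "\<rho> * sin (\<alpha> - \<bar>\<theta>\<bar>) > 0" using a N unfolding gap by (simp add: zero_less_divide_iff)
  have \<rho>: "\<rho> > 0" using pos \<rho>0 by (cases "\<rho> = 0") auto
  have \<theta>: "\<bar>\<theta>\<bar> < \<alpha>"
  proof (rule ccontr)
    assume "\<not> \<bar>\<theta>\<bar> < \<alpha>"
    hence "sin (\<bar>\<theta>\<bar> - \<alpha>) \<ge> 0" using \<theta>pi \<alpha> by (intro sin_ge_zero) auto
    moreover have "sin (\<alpha> - \<bar>\<theta>\<bar>) = - sin (\<bar>\<theta>\<bar> - \<alpha>)" by (metis minus_diff_eq sin_minus)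
    ultimately show False using pos mult_nonneg_nonneg[OF \<rho>0, of "sin (\<bar>\<theta>\<bar> - \<alpha>)"] by simp
  qed
  have \<kappa>\<theta>: "\<bar>\<kappa> * \<theta>\<bar> < pi / 2"
    using mult_strict_left_mono[OF \<theta> \<kappa>(1)] \<kappa> by (simp add: abs_mult)
  define \<omega> where "\<omega> = cis (\<kappa> * \<theta>)"
  have Re\<omega>: "Re \<omega> > 0" using \<kappa>\<theta> by (auto simp: \<omega>_def intro!: cos_gt_zero_pi)
  define h where "h = (\<lambda>u. (\<omega> + cnj \<omega> * u) / (1 - u))"
  have Reh: "Re (h u) > 0" if "cmod u < 1" for u
    unfolding h_def by (rule Re_disc_to_half_plane_pos[OF Re\<omega> that])
  define w where "w = (\<lambda>u. of_real \<rho> * exp (Ln (h u) / of_real \<kappa>))"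
  have w_polar: "w u = of_real (\<rho> * exp (Re (Ln (h u)) / \<kappa>)) * cis (Im (Ln (h u)) / \<kappa>)" for u
    by (simp add: w_def exp_eq_polar)
  have w_arg: "\<bar>Im (Ln (h u)) / \<kappa>\<bar> < \<alpha>" if "cmod u < 1" for u
  proof -
    have "\<bar>Im (Ln (h u))\<bar> < pi / 2" using Reh[OF that] Re_Ln_pos_lt[of "h u"] by fastforce
    thus ?thesis using \<kappa> by (simp add: abs_divide divide_less_eq mult.commute)
  qed
  have w_gap: "sin \<alpha> * Re (w u) - cos \<alpha> * \<bar>Im (w u)\<bar> > 0" if "cmod u < 1" for u
  proof -
    have "sin (\<alpha> - \<bar>Im (Ln (h u)) / \<kappa>\<bar>) > 0"
      using w_arg[OF that] \<alpha> pi_gt_zero by (intro sin_gt_zero) linarith+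
    hence "\<rho> * exp (Re (Ln (h u)) / \<kappa>) * sin (\<alpha> - \<bar>Im (Ln (h u)) / \<kappa>\<bar>) > 0" using \<rho> by simp
    thus ?thesis unfolding w_polar using w_arg[OF that] \<alpha> \<rho> by (subst sector_gap) auto
  qed
  have w1: "w u \<noteq> - 1" if "cmod u < 1" for u
    using w_gap[OF that] sc by auto
  define \<psi> where "\<psi> = (\<lambda>u. (w u - 1) / (w u + 1))"
  have hol: "\<psi> holomorphic_on ball 0 1"
  proof -
    have slit: "h u \<notin> \<real>\<^sub>\<le>\<^sub>0" if "cmod u < 1" for u
      using Reh[OF that] by (auto elim!: nonpos_Reals_cases)
    have "h holomorphic_on ball 0 1"
      unfolding h_def by (intro holomorphic_intros) auto
    hence "w holomorphic_on ball 0 1"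
      unfolding w_def by (intro holomorphic_intros) (use slit \<kappa> in auto)
    thus ?thesis unfolding \<psi>_def
      by (intro holomorphic_intros) (use w1 in \<open>auto simp: eq_neg_iff_add_eq_0\<close>)
  qed
  have "Ln \<omega> = \<i> * of_real (\<kappa> * \<theta>)"
    unfolding \<omega>_def cis_conv_exp by (rule Ln_exp) (use \<kappa>\<theta> in auto)
  hence w0: "w 0 = \<zeta>" using \<kappa> by (simp add: w_def h_def polar cis_conv_exp)
  hence \<psi>0: "\<psi> 0 = a" using \<zeta>(2) by (simp add: \<psi>_def)
  have gap\<psi>: "lens_gap \<alpha> (\<psi> u) > 0" if "cmod u < 1" for u
    unfolding \<psi>_def lens_gap_inverse_cayley[OF w1[OF that]]
    using w_gap[OF that] w1[OF that] by (simp add: eq_neg_iff_add_eq_0)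
  have deriv\<psi>: "cmod (deriv \<psi> 0) = 4 * \<rho> * cos (\<kappa> * \<theta>) / (\<kappa> * N)"
  proof -
    have \<omega>: "\<omega> \<noteq> 0" "\<omega> \<notin> \<real>\<^sub>\<le>\<^sub>0" using Re\<omega> by (auto elim!: nonpos_Reals_cases)
    have "(h has_field_derivative (\<omega> + cnj \<omega>)) (at 0)"
      unfolding h_def by (auto intro!: derivative_eq_intros)
    moreover have "h 0 = \<omega>" by (simp add: h_def)
    ultimately have "(w has_field_derivative w 0 * ((\<omega> + cnj \<omega>) / (\<omega> * of_real \<kappa>))) (at 0)"
      unfolding w_def using \<omega> \<kappa> by (auto intro!: derivative_eq_intros simp: field_simps)
    moreover have "(\<psi> has_field_derivative 2 * D / (w 0 + 1)\<^sup>2) (at 0)"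
      if D: "(w has_field_derivative D) (at 0)" for D
      unfolding \<psi>_def using w1[of 0]
      by (auto intro!: derivative_eq_intros D simp: eq_neg_iff_add_eq_0 power2_eq_square algebra_simps)
    ultimately have "(\<psi> has_field_derivative 2 * (w 0 * ((\<omega> + cnj \<omega>) / (\<omega> * of_real \<kappa>))) / (w 0 + 1)\<^sup>2) (at 0)"
      by blast
    hence "deriv \<psi> 0 = 2 * (\<zeta> * ((\<omega> + cnj \<omega>) / (\<omega> * of_real \<kappa>))) / (\<zeta> + 1)\<^sup>2"
      unfolding w0 by (rule DERIV_imp_deriv)
    moreover have "cmod (\<omega> + cnj \<omega>) = 2 * cos (\<kappa> * \<theta>)"
      using Re\<omega> by (simp add: complex_add_cnj \<omega>_def)
    moreover have "cmod \<omega> = 1" by (simp add: \<omega>_def)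
    ultimately show ?thesis using \<kappa>
      by (simp add: norm_divide norm_mult norm_power \<rho>_def N_def)
  qed
  have "sin (\<alpha> - \<bar>\<theta>\<bar>) \<le> sin \<alpha> * cos (\<kappa> * \<theta>)"
  proof -
    have "sin (\<alpha> - \<bar>\<theta>\<bar>) \<le> sin \<alpha> * sin (\<kappa> * (\<alpha> - \<bar>\<theta>\<bar>))"
      unfolding \<kappa>_def by (rule sin_le_sin_mult_sin[OF \<alpha>]) (use \<theta> in auto)
    also have "\<kappa> * (\<alpha> - \<bar>\<theta>\<bar>) = pi / 2 - \<bar>\<kappa> * \<theta>\<bar>" using \<kappa> by (simp add: right_diff_distrib abs_mult)
    also have "sin \<dots> = cos (\<kappa> * \<theta>)" by (simp add: sin_diff)
    finally show ?thesis .
  qed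
  hence "\<rho> * sin (\<alpha> - \<bar>\<theta>\<bar>) \<le> \<rho> * (sin \<alpha> * cos (\<kappa> * \<theta>))" using \<rho> by simp
  hence "4 * (\<rho> * sin (\<alpha> - \<bar>\<theta>\<bar>)) / N \<le> 4 * (\<rho> * (sin \<alpha> * cos (\<kappa> * \<theta>))) / N"
    using N by (intro divide_right_mono) auto
  moreover have "pi * sin \<alpha> / (2 * \<alpha>) * cmod (deriv \<psi> 0) = 4 * (\<rho> * (sin \<alpha> * cos (\<kappa> * \<theta>))) / N"
  proof -
    have "pi * sin \<alpha> / (2 * \<alpha>) = \<kappa> * sin \<alpha>" by (simp add: \<kappa>_def)
    thus ?thesis unfolding deriv\<psi> using \<kappa> by simp
  qed
  ultimately have "lens_gap \<alpha> a \<le> pi * sin \<alpha> / (2 * \<alpha>) * cmod (deriv \<psi> 0)"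
    unfolding gap by simp
  thus ?thesis using that hol \<psi>0 gap\<psi> by blast
qed

text \<open>Schwarz--Pick for \<open>f \<circ> \<psi>\<close>, with \<open>\<psi>\<close> the disc map above. The gap plays the role of \<open>1 - \<bar>a\<bar>\<^sup>2\<close> in the disc:
  it is at most \<open>\<pi> sin \<alpha> / (2 \<alpha>)\<close> times \<open>\<bar>\<psi>'(0)\<bar>\<close>, the reciprocal of the hyperbolic density at \<open>a\<close>.\<close>

lemma Schwarz_Pick_lens:
  assumes \<alpha>: "0 < \<alpha>" "\<alpha> \<le> pi / 2" and a: "lens_gap \<alpha> a > 0"
    and f: "f holomorphic_on {z. lens_gap \<alpha> z > 0}"
    and f1: "\<And>z. lens_gap \<alpha> z > 0 \<Longrightarrow> cmod (f z) < 1"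
  shows "lens_gap \<alpha> a * cmod (deriv f a) \<le> pi * sin \<alpha> / (2 * \<alpha>) * (1 - (cmod (f a))\<^sup>2)"
proof -
  obtain \<psi> where \<psi>: "\<psi> holomorphic_on ball 0 1" "\<psi> 0 = a"
    "\<And>u. cmod u < 1 \<Longrightarrow> lens_gap \<alpha> (\<psi> u) > 0"
    and le: "lens_gap \<alpha> a \<le> pi * sin \<alpha> / (2 * \<alpha>) * cmod (deriv \<psi> 0)"
    by (rule lens_interior_disc_map[OF \<alpha> a]) blast
  have "open {z. lens_gap \<alpha> z > 0}"
    unfolding lens_gap_def by (intro open_Collect_less continuous_intros)
  hence "(f has_field_derivative deriv f a) (at (\<psi> 0))"
    using f a holomorphic_derivI \<psi>(2) by blast
  moreover have "(\<psi> has_field_derivative deriv \<psi> 0) (at 0)"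
    using \<psi>(1) holomorphic_derivI[of \<psi> "ball 0 1" 0] by simp
  ultimately have "deriv (f \<circ> \<psi>) 0 = deriv f a * deriv \<psi> 0"
    by (intro DERIV_imp_deriv DERIV_chain)
  moreover have "cmod (deriv (f \<circ> \<psi>) 0) \<le> 1 - (cmod ((f \<circ> \<psi>) 0))\<^sup>2"
    using \<psi> f f1 by (intro Schwarz_Pick_at_0 holomorphic_on_compose_gen[OF \<psi>(1) f]) auto
  ultimately have pick: "cmod (deriv f a) * cmod (deriv \<psi> 0) \<le> 1 - (cmod (f a))\<^sup>2"
    by (simp add: norm_mult \<psi>(2))
  let ?C = "pi * sin \<alpha> / (2 * \<alpha>)"
  have "lens_gap \<alpha> a * cmod (deriv f a) \<le> ?C * cmod (deriv \<psi> 0) * cmod (deriv f a)"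
    using le by (rule mult_right_mono) simp
  also have "\<dots> = ?C * (cmod (deriv f a) * cmod (deriv \<psi> 0))" by (simp only: mult_ac)
  also have "\<dots> \<le> ?C * (1 - (cmod (f a))\<^sup>2)"
    using pick \<alpha> sin_cos_lens_angle[OF \<alpha>] by (intro mult_left_mono) auto
  finally show ?thesis .
qed

section \<open>The upper bound\<close>

text \<open>Since \<open>sin u \<le> sin \<alpha> sin (\<kappa> u) \<le> \<kappa> sin \<alpha> u\<close> for small \<open>u > 0\<close>, comparing slopes at \<open>0\<close> gives
  \<open>1 \<le> \<kappa> sin \<alpha>\<close>.\<close>

lemma lens_constant_ge_1:
  assumes \<alpha>: "0 < \<alpha>" "\<alpha> \<le> pi / 2"
  shows "pi * sin \<alpha> / (2 * \<alpha>) \<ge> 1"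
proof (rule ccontr)
  define \<kappa> where "\<kappa> = pi / (2 * \<alpha>)"
  have \<kappa>: "\<kappa> > 0" "\<kappa> * \<alpha> = pi / 2" using \<alpha> by (simp_all add: \<kappa>_def)
  assume "\<not> ?thesis"
  hence C: "1 - \<kappa> * sin \<alpha> > 0" by (simp add: \<kappa>_def)
  have "((\<lambda>u. sin u - \<kappa> * sin \<alpha> * u) has_real_derivative 1 - \<kappa> * sin \<alpha>) (at 0)"
    by (auto intro!: derivative_eq_intros)
  from DERIV_pos_inc_right[OF this C] obtain d where d: "d > 0"
    and inc: "\<And>h. h > 0 \<Longrightarrow> h < d \<Longrightarrow> \<kappa> * sin \<alpha> * h < sin h" by auto
  define u where "u = min (d / 2) \<alpha>"
  have u: "0 < u" "u < d" "u \<le> \<alpha>" using d \<alpha> by (auto simp: u_def)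
  have "sin u \<le> sin \<alpha> * sin (\<kappa> * u)"
    unfolding \<kappa>_def by (rule sin_le_sin_mult_sin[OF \<alpha>]) (use u in auto)
  also have "\<dots> \<le> sin \<alpha> * (\<kappa> * u)"
    using sin_cos_lens_angle[OF \<alpha>] sin_x_le_x[of "\<kappa> * u"] \<kappa> u by (intro mult_left_mono) auto
  finally show False using inc[OF u(1,2)] by (simp add: mult_ac)
qed

lemma compact_lens:
  assumes \<alpha>: "0 < \<alpha>" "\<alpha> \<le> pi / 2"
  shows "compact (lens \<alpha>)"
proof -
  have "closed (lens \<alpha>)" unfolding lens_def
    by (intro closed_Int closed_Collect_le continuous_intros)
  moreover have "lens \<alpha> \<subseteq> cball (\<i> * complex_of_real (cot \<alpha>)) (1 / sin \<alpha>)"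
    by (auto simp: lens_def dist_norm norm_minus_commute)
  ultimately show ?thesis
    by (meson bounded_cball bounded_subset compact_eq_bounded_closed)
qed

lemma lens_subset_cball:
  assumes \<alpha>: "0 < \<alpha>" "\<alpha> \<le> pi / 2" and z: "z \<in> lens \<alpha>"
  shows "cmod z \<le> 1"
proof -
  note sc = sin_cos_lens_angle[OF \<alpha>]
  have "0 \<le> 2 * cos \<alpha> * \<bar>Im z\<bar>" using sc by simp
  moreover have "0 \<le> lens_gap \<alpha> z" using z mem_lens_iff[OF \<alpha>] by simp
  ultimately have "0 \<le> sin \<alpha> * (1 - (cmod z)\<^sup>2)" unfolding lens_gap_def by linarith
  hence "(cmod z)\<^sup>2 \<le> 1" using sc by (simp add: zero_le_mult_iff)
  thus ?thesis by (simp add: abs_square_le_1)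
qed

lemma cmod_poly_le_SUP_lens:
  assumes "0 < \<alpha>" "\<alpha> \<le> pi / 2" "z \<in> lens \<alpha>"
  shows "cmod (poly p z) \<le> (SUP z\<in>lens \<alpha>. cmod (poly p z))"
proof -
  have "compact ((\<lambda>z. cmod (poly p z)) ` lens \<alpha>)"
    by (intro compact_continuous_image compact_lens continuous_intros assms)
  thus ?thesis by (intro cSUP_upper bounded_imp_bdd_above compact_imp_bounded assms)
qed

lemma one_mem_lens: "0 < \<alpha> \<Longrightarrow> \<alpha> \<le> pi / 2 \<Longrightarrow> 1 \<in> lens \<alpha>"
  by (simp add: mem_lens_iff lens_gap_def)

lemma SUP_lens_nonneg:
  assumes "0 < \<alpha>" "\<alpha> \<le> pi / 2"
  shows "(SUP z\<in>lens \<alpha>. cmod (poly p z)) \<ge> 0"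
  using cmod_poly_le_SUP_lens[OF assms one_mem_lens[OF assms], of p] norm_ge_zero order_trans by blast

lemma square_zero_scaleC:
  assumes "square_zero (M::'h::chilbert_space \<Rightarrow> 'h)"
  shows "square_zero (\<lambda>x. c *\<^sub>C M x)"
proof -
  have Mb: "bounded_clinear M" and MM: "\<And>x. M (M x) = 0" using assms by (auto simp: square_zero_def)
  from bounded_linear_compose[OF bounded_linear_scaleC bounded_clinearD(1)[OF Mb]]
  have "bounded_clinear (\<lambda>x. c *\<^sub>C M x)"
    by (simp add: bounded_clinear_def bounded_clinearD(5)[OF Mb] scaleC_scaleC mult.commute)
  thus ?thesis by (simp add: square_zero_def bounded_clinearD(5)[OF Mb] MM)
qed

text \<open>By the Taylor formula \<open>p(A) = p(a) + p'(a) M\<close> with \<open>\<parallel>p'(a) M\<parallel> \<le> m\<close>, and Schwarz--Pick for \<open>p / K\<close> gives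
  \<open>m K \<le> C (K\<^sup>2 - \<bar>p(a)\<bar>\<^sup>2)\<close>. By the norm criterion for Jordan blocks, \<open>\<parallel>p(A)\<parallel> \<le> C K\<close> follows from
  \<open>m C K \<le> C\<^sup>2 K\<^sup>2 - \<bar>p(a)\<bar>\<^sup>2\<close>, and \<open>C \<ge> 1\<close> leaves room. The strict bound by \<open>K\<close> is what the
  Schwarz lemma asks for; the next lemma lets \<open>K\<close> decrease to the maximum.\<close>

lemma norm_poly_op_lens_class_less:
  assumes \<alpha>: "0 < \<alpha>" "\<alpha> \<le> pi / 2" and A: "A \<in> (lens_class \<alpha> :: ('h::chilbert_space \<Rightarrow> 'h) set)"
    and K: "\<And>z. z \<in> lens \<alpha> \<Longrightarrow> cmod (poly p z) < K"
  shows "norm (poly_op p A x) \<le> pi * sin \<alpha> / (2 * \<alpha>) * K * norm x"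
proof (cases "x = 0")
  case True
  have Ab: "bounded_clinear A" using A by (simp add: lens_class_def)
  have "(A ^^ i) 0 = 0" for i by (induction i) (simp_all add: bounded_clinearD(4)[OF Ab])
  thus ?thesis using True by (simp add: poly_op_def)
next
  case False
  define C where "C = pi * sin \<alpha> / (2 * \<alpha>)"
  have C: "C \<ge> 1" unfolding C_def by (rule lens_constant_ge_1[OF \<alpha>])
  have K0: "K > 0" using K[OF one_mem_lens[OF \<alpha>]] norm_ge_zero le_less_trans by blast
  obtain a M where M: "square_zero M" and AM: "\<And>x. A x = a *\<^sub>C x + M x"
    by (rule lens_class_shifted_square_zero[OF A False]) blast
  have bound: "norm (M y) \<le> lens_gap \<alpha> a * norm y" for y
    by (rule lens_class_nilpotent_bound[OF \<alpha> A M AM])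
  have "0 \<le> lens_gap \<alpha> a * norm x" using bound[of x] norm_ge_zero order_trans by blast
  hence gap: "lens_gap \<alpha> a \<ge> 0" using False by (simp add: zero_le_mult_iff)
  hence pa: "cmod (poly p a) < K" by (intro K) (simp add: mem_lens_iff[OF \<alpha>])
  define m where "m = lens_gap \<alpha> a * cmod (poly (pderiv p) a)"
  have pick: "m * K \<le> C * (K\<^sup>2 - (cmod (poly p a))\<^sup>2)"
  proof (cases "lens_gap \<alpha> a = 0")
    case True
    have "(cmod (poly p a))\<^sup>2 \<le> K\<^sup>2" using pa by (intro power_mono) auto
    thus ?thesis using True C by (simp add: m_def)
  next
    case False
    define f where "f = (\<lambda>z. poly p z / of_real K)"
    have f': "(f has_field_derivative poly (pderiv p) a / of_real K) (at a)"
      unfolding f_def using K0 by (auto intro!: derivative_eq_intros poly_DERIV)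
    have fn: "cmod (f z) = cmod (poly p z) / K" for z using K0 by (simp add: f_def norm_divide)
    have "lens_gap \<alpha> a * cmod (deriv f a) \<le> C * (1 - (cmod (f a))\<^sup>2)" unfolding C_def
    proof (rule Schwarz_Pick_lens[OF \<alpha>])
      show "f holomorphic_on {z. lens_gap \<alpha> z > 0}"
        unfolding f_def using K0 by (intro holomorphic_intros) auto
      show "cmod (f z) < 1" if "lens_gap \<alpha> z > 0" for z
        using K[of z] that K0 by (simp add: fn mem_lens_iff[OF \<alpha>])
    qed (use False gap in simp)
    hence "m / K \<le> C * (1 - (cmod (poly p a) / K)\<^sup>2)"
      using K0 by (simp add: m_def DERIV_imp_deriv[OF f'] fn norm_divide)
    hence "m / K * K\<^sup>2 \<le> C * (1 - (cmod (poly p a) / K)\<^sup>2) * K\<^sup>2"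
      by (rule mult_right_mono) simp
    moreover have "m / K * K\<^sup>2 = m * K" using K0 by (simp add: power2_eq_square)
    moreover have "C * (1 - (cmod (poly p a) / K)\<^sup>2) * K\<^sup>2 = C * (K\<^sup>2 - (cmod (poly p a))\<^sup>2)"
      using K0 by (simp add: power_divide left_diff_distrib mult.assoc)
    ultimately show ?thesis by simp
  qed
  have "norm (poly p a *\<^sub>C x + poly (pderiv p) a *\<^sub>C M x) \<le> C * K * norm x"
  proof (rule norm_shifted_square_zero_le[OF square_zero_scaleC[OF M], where m = m])
    show "C * K > 0" using C K0 by simp
    show "cmod (poly p a) \<le> C * K" using pa C K0 by (smt (verit) mult_le_cancel_right1)
    show "norm (poly (pderiv p) a *\<^sub>C M y) \<le> m * norm y" for y
      using mult_left_mono[OF bound[of y] norm_ge_zero[of "poly (pderiv p) a"]]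
      by (simp add: m_def mult_ac)
    have "m * (C * K) = C * (m * K)" by simp
    also have "\<dots> \<le> C * (C * (K\<^sup>2 - (cmod (poly p a))\<^sup>2))" using pick C by (intro mult_left_mono) auto
    also have "\<dots> = (C * K)\<^sup>2 - C\<^sup>2 * (cmod (poly p a))\<^sup>2" by (simp add: power2_eq_square algebra_simps)
    also have "\<dots> \<le> (C * K)\<^sup>2 - 1 * (cmod (poly p a))\<^sup>2"
      using C by (intro diff_left_mono mult_right_mono) auto
    finally show "m * (C * K) \<le> (C * K)\<^sup>2 - (cmod (poly p a))\<^sup>2" by simp
  qed
  thus ?thesis
    using poly_op_shifted_square_zero[OF M _ AM, of p x] A by (simp add: lens_class_def C_def)
qed

lemma norm_poly_op_lens_class:
  assumes \<alpha>: "0 < \<alpha>" "\<alpha> \<le> pi / 2" and A: "A \<in> (lens_class \<alpha> :: ('h::chilbert_space \<Rightarrow> 'h) set)"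
  shows "norm (poly_op p A x)
    \<le> pi * sin \<alpha> / (2 * \<alpha>) * (SUP z\<in>lens \<alpha>. cmod (poly p z)) * norm x"
proof (rule tendsto_lowerbound)
  let ?S = "SUP z\<in>lens \<alpha>. cmod (poly p z)"
  show "((\<lambda>K. pi * sin \<alpha> / (2 * \<alpha>) * K * norm x) \<longlongrightarrow> pi * sin \<alpha> / (2 * \<alpha>) * ?S * norm x) (at_right ?S)"
    by (intro tendsto_intros)
  have "norm (poly_op p A x) \<le> pi * sin \<alpha> / (2 * \<alpha>) * K * norm x" if "K > ?S" for K
    using cmod_poly_le_SUP_lens[OF \<alpha>, of _ p] that le_less_trans
    by (intro norm_poly_op_lens_class_less[OF \<alpha> A]) blast
  thus "\<forall>\<^sub>F K in at_right ?S. norm (poly_op p A x) \<le> pi * sin \<alpha> / (2 * \<alpha>) * K * norm x"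
    by (auto simp: eventually_at_filter)
qed simp

lemma poly_op_sum_one:
  "poly_op p (sum_one A) (x :: 'h::chilbert_space, k :: 'k::chilbert_space) = (poly_op p A x, poly p 1 *\<^sub>C k)"
proof -
  have pow: "((map_prod A id) ^^ i) (x, k) = ((A ^^ i) x, k)" for i by (induction i) auto
  have "(\<Sum>i\<in>I. coeff p i *\<^sub>C k) = (\<Sum>i\<in>I. coeff p i) *\<^sub>C k" for I
    by (induction I rule: infinite_finite_induct) (auto simp: scaleC_add_left)
  thus ?thesis
    by (simp add: poly_op_def sum_one_def pow scaleC_prod_def prod_eq_iff fst_sum snd_sum poly_altdef)
qed

text \<open>The added summand contributes only \<open>p(1)\<close>, and \<open>1\<close> is a vertex of the lens, so the bound
  on the direct sum is the larger of \<open>C\<close> and \<open>1\<close> times the maximum of \<open>\<bar>p\<bar>\<close>.\<close>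

lemma norm_poly_op_sum_one:
  assumes \<alpha>: "0 < \<alpha>" "\<alpha> \<le> pi / 2"
    and B: "B \<in> sum_one ` (lens_class \<alpha> :: ('h::chilbert_space \<Rightarrow> 'h) set)"
  shows "norm (poly_op p B (y :: 'h \<times> 'k::chilbert_space))
    \<le> pi * sin \<alpha> / (2 * \<alpha>) * (SUP z\<in>lens \<alpha>. cmod (poly p z)) * norm y"
proof -
  obtain A where A: "A \<in> (lens_class \<alpha> :: ('h \<Rightarrow> 'h) set)" and BA: "B = sum_one A" using B by blast
  obtain x k where y: "y = (x, k)" by fastforce
  define S where "S = (SUP z\<in>lens \<alpha>. cmod (poly p z))"
  define c where "c = pi * sin \<alpha> / (2 * \<alpha>) * S"
  have "S \<ge> 0" unfolding S_def by (rule SUP_lens_nonneg[OF \<alpha>])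
  hence c: "S \<le> c" "c \<ge> 0"
    using lens_constant_ge_1[OF \<alpha>] mult_right_mono[of 1 _ S] by (fastforce simp: c_def)+
  have "norm (poly_op p A x) \<le> c * norm x"
    unfolding c_def S_def by (rule norm_poly_op_lens_class[OF \<alpha> A])
  moreover have "norm (poly p 1 *\<^sub>C k) \<le> c * norm k"
    using cmod_poly_le_SUP_lens[OF \<alpha> one_mem_lens[OF \<alpha>], of p] c(1)
    by (simp add: S_def[symmetric] mult_right_mono)
  ultimately have "norm (poly_op p B y) \<le> sqrt ((c * norm x)\<^sup>2 + (c * norm k)\<^sup>2)"
    unfolding BA y poly_op_sum_one norm_Pair by (intro real_sqrt_le_mono add_mono power_mono) auto
  also have "\<dots> = c * norm y"
    using c(2) by (simp add: y norm_Pair power_mult_distrib real_sqrt_mult flip: distrib_left)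
  finally show ?thesis by (simp add: c_def S_def)
qed

lemma ratios_le_lens_constant:
  assumes \<alpha>: "0 < \<alpha>" "\<alpha> \<le> pi / 2"
    and bound: "\<And>A p x. A \<in> T \<Longrightarrow> norm (poly_op p A x)
      \<le> pi * sin \<alpha> / (2 * \<alpha>) * (SUP z\<in>lens \<alpha>. cmod (poly p z)) * norm (x :: 'h::chilbert_space)"
    and r: "r \<in> ratios \<alpha> T"
  shows "r \<le> pi * sin \<alpha> / (2 * \<alpha>)"
proof -
  obtain A p where A: "A \<in> T"
    and r: "r = onorm (poly_op p A) / (SUP z\<in>lens \<alpha>. cmod (poly p z))"
    using r by (auto simp: ratios_def)
  define S where "S = (SUP z\<in>lens \<alpha>. cmod (poly p z))"
  have S: "S \<ge> 0" unfolding S_def by (rule SUP_lens_nonneg[OF \<alpha>])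
  have C: "pi * sin \<alpha> / (2 * \<alpha>) \<ge> 1" by (rule lens_constant_ge_1[OF \<alpha>])
  have "onorm (poly_op p A) \<le> pi * sin \<alpha> / (2 * \<alpha>) * S"
    by (rule onorm_bound) (use S C bound[OF A, of p] in \<open>auto simp: S_def simp del: times_divide_eq_left\<close>)
  thus ?thesis using S C unfolding r S_def[symmetric]
    by (cases "S = 0") (auto simp: pos_divide_le_eq)
qed

section \<open>Uniform approximation by polynomials\<close>

text \<open>On a compact set the approximable functions form an algebra
  that is closed under uniform limits, hence under composition with holomorphic functions on discs.
  For the functions that occur below this takes the place of Runge's theorem.\<close>

definition poly_approximable :: "complex set \<Rightarrow> (complex \<Rightarrow> complex) \<Rightarrow> bool" where
  "poly_approximable S f \<longleftrightarrow> (\<forall>e>0. \<exists>p. \<forall>z\<in>S. cmod (f z - poly p z) < e)"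

lemma poly_approximable_poly: "poly_approximable S (poly p)"
  unfolding poly_approximable_def by (metis cancel_comm_monoid_add_class.diff_cancel norm_zero)

lemma poly_approximable_const: "poly_approximable S (\<lambda>z. k)"
proof -
  have "poly [:k:] = (\<lambda>z. k)" by auto
  thus ?thesis using poly_approximable_poly[of S "[:k:]"] by simp
qed

lemma bounded_poly_image:
  assumes "compact (S :: complex set)"
  obtains B where "B > 0" "\<And>z. z \<in> S \<Longrightarrow> cmod (poly p z) \<le> B"
proof -
  have "bounded (poly p ` S)"
    by (intro compact_imp_bounded compact_continuous_image continuous_intros assms)
  thus ?thesis using that unfolding bounded_pos by blast
qed

lemma poly_approximable_bounded:
  assumes "compact S" "poly_approximable S f"
  obtains B where "B > 0" "\<And>z. z \<in> S \<Longrightarrow> cmod (f z) \<le> B"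
proof -
  obtain p where p: "\<And>z. z \<in> S \<Longrightarrow> cmod (f z - poly p z) < 1"
    using assms(2) zero_less_one unfolding poly_approximable_def by blast
  obtain B where B: "B > 0" "\<And>z. z \<in> S \<Longrightarrow> cmod (poly p z) \<le> B"
    by (rule bounded_poly_image[OF assms(1), of p]) blast
  have "cmod (f z) \<le> B + 1" if "z \<in> S" for z
    using p[OF that] B(2)[OF that] norm_triangle_sub[of "f z" "poly p z"] by linarith
  thus ?thesis using that[of "B + 1"] B(1) by simp
qed

lemma poly_approximable_add:
  assumes "poly_approximable S f" "poly_approximable S g"
  shows "poly_approximable S (\<lambda>z. f z + g z)"
  unfolding poly_approximable_def
proof (intro allI impI)
  fix e :: real assume "e > 0"
  then obtain p q where pq: "\<And>z. z \<in> S \<Longrightarrow> cmod (f z - poly p z) < e / 2"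
      "\<And>z. z \<in> S \<Longrightarrow> cmod (g z - poly q z) < e / 2"
    using assms unfolding poly_approximable_def by (meson half_gt_zero)
  have "cmod (f z + g z - poly (p + q) z) < e" if "z \<in> S" for z
    using norm_triangle_ineq[of "f z - poly p z" "g z - poly q z"] pq[OF that]
    by (simp add: algebra_simps)
  thus "\<exists>p. \<forall>z\<in>S. cmod (f z + g z - poly p z) < e" by blast
qed

lemma poly_approximable_mult:
  assumes S: "compact S" and f: "poly_approximable S f" and g: "poly_approximable S g"
  shows "poly_approximable S (\<lambda>z. f z * g z)"
  unfolding poly_approximable_def
proof (intro allI impI)
  fix e :: real assume e: "e > 0"
  obtain B where B: "B > 0" "\<And>z. z \<in> S \<Longrightarrow> cmod (f z) \<le> B"
    using poly_approximable_bounded[OF S f] by blast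
  have "e / (2 * B) > 0" using e B(1) by simp
  then obtain q where q: "\<And>z. z \<in> S \<Longrightarrow> cmod (g z - poly q z) < e / (2 * B)"
    using g unfolding poly_approximable_def by blast
  obtain D where D: "D > 0" "\<And>z. z \<in> S \<Longrightarrow> cmod (poly q z) \<le> D"
    using bounded_poly_image[OF S] by blast
  have "e / (2 * D) > 0" using e D(1) by simp
  then obtain p where p: "\<And>z. z \<in> S \<Longrightarrow> cmod (f z - poly p z) < e / (2 * D)"
    using f unfolding poly_approximable_def by blast
  have "cmod (f z * g z - poly (p * q) z) < e" if z: "z \<in> S" for z
  proof -
    have "f z * g z - poly (p * q) z = f z * (g z - poly q z) + (f z - poly p z) * poly q z"
      by (simp add: algebra_simps)
    hence "cmod (f z * g z - poly (p * q) z)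
        \<le> cmod (f z) * cmod (g z - poly q z) + cmod (f z - poly p z) * cmod (poly q z)"
      by (metis norm_mult norm_triangle_ineq)
    also have "cmod (f z) * cmod (g z - poly q z) \<le> B * cmod (g z - poly q z)"
      using B(2)[OF z] by (rule mult_right_mono) simp
    also have "\<dots> < B * (e / (2 * B))" using q[OF z] B(1) by (rule mult_strict_left_mono)
    also have "cmod (f z - poly p z) * cmod (poly q z) \<le> cmod (f z - poly p z) * D"
      using D(2)[OF z] by (rule mult_left_mono) simp
    also have "\<dots> < e / (2 * D) * D" using p[OF z] D(1) by (rule mult_strict_right_mono)
    finally show ?thesis using B(1) D(1) by simp
  qed
  thus "\<exists>p. \<forall>z\<in>S. cmod (f z * g z - poly p z) < e" by blast
qed

lemma poly_approximable_power:
  assumes "compact S" "poly_approximable S f"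
  shows "poly_approximable S (\<lambda>z. f z ^ n)"
proof (induction n)
  case 0
  show ?case by (simp add: poly_approximable_const)
next
  case (Suc n)
  thus ?case using poly_approximable_mult[OF assms] by simp
qed

lemma poly_approximable_sum:
  assumes "\<And>i. i \<in> I \<Longrightarrow> poly_approximable S (f i)"
  shows "poly_approximable S (\<lambda>z. \<Sum>i\<in>I. f i z)"
  using assms
proof (induction I rule: infinite_finite_induct)
  case (insert i I)
  thus ?case by (simp add: poly_approximable_add)
qed (simp_all add: poly_approximable_const)

lemma poly_approximable_limit:
  assumes "\<And>e. e > 0 \<Longrightarrow> \<exists>g. poly_approximable S g \<and> (\<forall>z\<in>S. cmod (f z - g z) < e)"
  shows "poly_approximable S f"
  unfolding poly_approximable_def
proof (intro allI impI)
  fix e :: real assume e: "e > 0"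
  then obtain g where g: "poly_approximable S g" "\<And>z. z \<in> S \<Longrightarrow> cmod (f z - g z) < e / 2"
    using assms[of "e / 2"] by auto
  obtain p where p: "\<And>z. z \<in> S \<Longrightarrow> cmod (g z - poly p z) < e / 2"
    using g(1) e unfolding poly_approximable_def by (meson half_gt_zero)
  have "cmod (f z - poly p z) < e" if "z \<in> S" for z
    using norm_triangle_ineq[of "f z - g z" "g z - poly p z"] g(2)[OF that] p[OF that] by simp
  thus "\<exists>p. \<forall>z\<in>S. cmod (f z - poly p z) < e" by blast
qed

text \<open>The Taylor series of \<open>h\<close> converges uniformly on the smaller disc, and its partial sums evaluated at
  \<open>g\<close> are approximable because approximable functions form an algebra.\<close>

lemma poly_approximable_compose:
  assumes S: "compact S" and g: "poly_approximable S g"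
    and h: "h holomorphic_on ball c R" and r: "r < R" and gr: "\<And>z. z \<in> S \<Longrightarrow> cmod (g z - c) \<le> r"
  shows "poly_approximable S (\<lambda>z. h (g z))"
proof (cases "S = {}")
  case True
  thus ?thesis by (simp add: poly_approximable_def)
next
  case False
  then obtain z0 where "z0 \<in> S" by blast
  hence r0: "r \<ge> 0" using gr norm_ge_zero order_trans by blast
  define a where "a = (\<lambda>n. (deriv ^^ n) h c / fact n)"
  have series: "(\<lambda>n. a n * (w - c) ^ n) sums h w" if "w \<in> ball c R" for w
    unfolding a_def by (rule holomorphic_power_series[OF h that])
  define s where "s = (r + R) / 2"
  have s: "r < s" "s < R" "s > 0" using r r0 by (auto simp: s_def)
  have "c + of_real s \<in> ball c R" using s by (simp add: dist_norm)
  hence "summable (\<lambda>n. a n * (of_real s) ^ n)" using series[of "c + of_real s"] sums_summable by fastforce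
  hence "ereal (norm (complex_of_real s)) \<le> conv_radius a" by (rule conv_radius_geI)
  hence "ereal r < conv_radius a" using s by (simp add: less_le_trans[of "ereal r" "ereal s"])
  hence lim: "uniform_limit (cball c r) (\<lambda>n x. \<Sum>i<n. a i * (x - c) ^ i)
      (\<lambda>x. suminf (\<lambda>i. a i * (x - c) ^ i)) sequentially"
    by (rule powser_uniform_limit)
  show ?thesis
  proof (rule poly_approximable_limit)
    fix e :: real assume "e > 0"
    then obtain n where n: "\<And>x. x \<in> cball c r \<Longrightarrow>
        dist (\<Sum>i<n. a i * (x - c) ^ i) (suminf (\<lambda>i. a i * (x - c) ^ i)) < e"
      using uniform_limitD[OF lim] eventually_sequentially by fastforce
    let ?g = "\<lambda>z. \<Sum>i<n. a i * (g z + (- c)) ^ i"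
    have "poly_approximable S ?g"
      by (intro poly_approximable_sum poly_approximable_mult poly_approximable_power
          poly_approximable_add poly_approximable_const S g)
    moreover have "cmod (h (g z) - ?g z) < e" if "z \<in> S" for z
    proof -
      have gz: "g z \<in> cball c r" using gr[OF that] by (simp add: dist_norm norm_minus_commute)
      hence "g z \<in> ball c R" using r by auto
      hence "h (g z) = suminf (\<lambda>i. a i * (g z - c) ^ i)" using series sums_unique by blast
      thus ?thesis using n[OF gz] by (simp add: dist_norm norm_minus_commute)
    qed
    ultimately show "\<exists>f. poly_approximable S f \<and> (\<forall>z\<in>S. cmod (h (g z) - f z) < e)" by blast
  qed
qed

section \<open>Polynomials that are almost extremal for the lens\<close>

text \<open>The functions \<open>\<Phi>(r z)\<close> to the power \<open>\<kappa>\<close> and \<open>tanh (\<kappa> artanh (r z))\<close>. For \<open>r = 1\<close> they are the conformal maps of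
  the lens onto the right half-plane and onto the disc, and the second one is extremal for the
  Schwarz--Pick inequality at \<open>0\<close>. In general both are singular at the vertices \<open>\<plusminus> 1\<close>; shrinking the
  argument by \<open>r < 1\<close> makes them holomorphic near the lens.\<close>

definition lens_half_plane_map :: "real \<Rightarrow> real \<Rightarrow> complex \<Rightarrow> complex" where
  "lens_half_plane_map \<alpha> r z = exp (of_real (pi / (2 * \<alpha>)) * Ln ((1 + of_real r * z) / (1 - of_real r * z)))"

definition lens_disc_map :: "real \<Rightarrow> real \<Rightarrow> complex \<Rightarrow> complex" where
  "lens_disc_map \<alpha> r z = (lens_half_plane_map \<alpha> r z - 1) / (lens_half_plane_map \<alpha> r z + 1)"

lemma cmod_scaled_lens_less_1:
  assumes "0 < \<alpha>" "\<alpha> \<le> pi / 2" "z \<in> lens \<alpha>" "0 < r" "r < 1"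
  shows "cmod (of_real r * z) < 1"
proof -
  have "r * cmod z \<le> r * 1" using assms lens_subset_cball by (intro mult_left_mono) auto
  also have "r * 1 < 1" using assms by simp
  finally show ?thesis using assms by (simp add: norm_mult)
qed

text \<open>The lens is star-shaped about \<open>0\<close>, quantitatively \<open>r * lens_gap \<alpha> z \<le> lens_gap \<alpha> (r z)\<close>.\<close>

lemma lens_gap_scaled:
  assumes \<alpha>: "0 < \<alpha>" "\<alpha> \<le> pi / 2" and z: "z \<in> lens \<alpha>" and r: "0 < r" "r < 1"
  shows "lens_gap \<alpha> (of_real r * z) \<ge> 0"
proof -
  note sc = sin_cos_lens_angle[OF \<alpha>]
  have "r\<^sup>2 \<le> r" using r by (simp add: power2_eq_square)
  hence "r\<^sup>2 * (cmod z)\<^sup>2 \<le> r * (cmod z)\<^sup>2" by (rule mult_right_mono) simp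
  hence "r * (1 - (cmod z)\<^sup>2) \<le> 1 - r\<^sup>2 * (cmod z)\<^sup>2"
    using r by (simp add: algebra_simps)
  hence "sin \<alpha> * (r * (1 - (cmod z)\<^sup>2)) \<le> sin \<alpha> * (1 - r\<^sup>2 * (cmod z)\<^sup>2)"
    using sc by (intro mult_left_mono) auto
  hence "r * lens_gap \<alpha> z \<le> lens_gap \<alpha> (of_real r * z)"
    using r by (simp add: lens_gap_def norm_mult power_mult_distrib abs_mult right_diff_distrib mult_ac)
  moreover have "r * lens_gap \<alpha> z \<ge> 0" using z r mem_lens_iff[OF \<alpha>] by simp
  ultimately show ?thesis by linarith
qed

text \<open>The point \<open>\<zeta> = \<Phi>(r z)\<close> lies in the sector \<open>\<bar>arg\<bar> \<le> \<alpha>\<close>, and raising to the power \<open>\<kappa>\<close> multiplies its argument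
  by \<open>\<pi> / (2 \<alpha>)\<close>.\<close>

lemma Re_lens_half_plane_map_nonneg:
  assumes \<alpha>: "0 < \<alpha>" "\<alpha> \<le> pi / 2" and z: "z \<in> lens \<alpha>" and r: "0 < r" "r < 1"
  shows "Re (lens_half_plane_map \<alpha> r z) \<ge> 0"
proof -
  define \<zeta> where "\<zeta> = (1 + of_real r * z) / (1 - of_real r * z)"
  define \<theta> where "\<theta> = Im (Ln \<zeta>)"
  have lt: "cmod (of_real r * z) < 1" by (rule cmod_scaled_lens_less_1[OF \<alpha> z r])
  have "of_real r * z \<noteq> 1" using lt by auto
  note inv = inverse_cayley_cayley[OF this \<zeta>_def]
  have Re: "Re \<zeta> > 0" unfolding \<zeta>_def by (rule Re_cayley_pos[OF lt])
  hence "\<zeta> \<noteq> 0" by auto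
  have \<theta>2: "\<bar>\<theta>\<bar> < pi / 2" unfolding \<theta>_def using Re_Ln_pos_lt[OF \<open>\<zeta> \<noteq> 0\<close>] Re by simp
  have "0 \<le> 4 * (sin \<alpha> * Re \<zeta> - cos \<alpha> * \<bar>Im \<zeta>\<bar>) / (cmod (\<zeta> + 1))\<^sup>2"
    using lens_gap_scaled[OF \<alpha> z r] lens_gap_inverse_cayley[OF inv(1), of \<alpha>] by (simp add: inv(2))
  hence "0 \<le> sin \<alpha> * Re \<zeta> - cos \<alpha> * \<bar>Im \<zeta>\<bar>"
    using inv(1) by (simp add: zero_le_divide_iff eq_neg_iff_add_eq_0)
  moreover have "\<zeta> = of_real (exp (Re (Ln \<zeta>))) * cis \<theta>"
    using exp_Ln[OF \<open>\<zeta> \<noteq> 0\<close>] exp_eq_polar[of "Ln \<zeta>"] by (simp add: \<theta>_def)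
  moreover have "\<bar>\<theta>\<bar> \<le> pi" using \<theta>2 pi_gt_zero by linarith
  ultimately have "0 \<le> exp (Re (Ln \<zeta>)) * sin (\<alpha> - \<bar>\<theta>\<bar>)"
    using sector_gap[of \<theta> "exp (Re (Ln \<zeta>))" \<alpha>] by simp
  hence sin: "sin (\<alpha> - \<bar>\<theta>\<bar>) \<ge> 0" by (simp add: zero_le_mult_iff)
  have \<theta>: "\<bar>\<theta>\<bar> \<le> \<alpha>"
  proof (rule ccontr)
    assume "\<not> \<bar>\<theta>\<bar> \<le> \<alpha>"
    hence "sin (\<bar>\<theta>\<bar> - \<alpha>) > 0" using \<theta>2 \<alpha> by (intro sin_gt_zero) linarith+
    moreover have "sin (\<alpha> - \<bar>\<theta>\<bar>) = - sin (\<bar>\<theta>\<bar> - \<alpha>)" by (metis minus_diff_eq sin_minus)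
    ultimately show False using sin by simp
  qed
  have "\<bar>pi / (2 * \<alpha>) * \<theta>\<bar> \<le> pi / 2"
    using mult_left_mono[OF \<theta>, of "pi / (2 * \<alpha>)"] \<alpha> by (simp add: abs_mult)
  hence "cos (pi / (2 * \<alpha>) * \<theta>) \<ge> 0" by (intro cos_ge_zero) linarith+
  thus ?thesis
    by (simp add: lens_half_plane_map_def Re_exp \<zeta>_def[symmetric] \<theta>_def)
qed

lemma cmod_cayley_le_1:
  assumes "Re w \<ge> 0"
  shows "w + 1 \<noteq> 0" "cmod ((w - 1) / (w + 1)) \<le> 1"
proof -
  show "w + 1 \<noteq> 0" using assms by (auto simp: complex_eq_iff)
  have "(cmod (w - 1))\<^sup>2 \<le> (cmod (w + 1))\<^sup>2"
    unfolding cmod_power2 using assms by (simp add: power2_eq_square algebra_simps)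
  hence "cmod (w - 1) \<le> cmod (w + 1)" by (rule power2_le_imp_le) simp
  thus "cmod ((w - 1) / (w + 1)) \<le> 1" using \<open>w + 1 \<noteq> 0\<close> by (simp add: norm_divide divide_le_eq)
qed

text \<open>The map is built from the identity by composing with \<open>w \<mapsto> Ln ((1 + w) / (1 - w))\<close> on the unit disc,
  with an entire exponential, and with \<open>w \<mapsto> (w - 1) / (w + 1)\<close>. A large disc in the half-plane
  \<open>Re w > -1\<close> is enough for the last step, because the values of \<open>E\<close> are bounded and have
  nonnegative real part.\<close>

lemma poly_approximable_lens_disc_map:
  assumes \<alpha>: "0 < \<alpha>" "\<alpha> \<le> pi / 2" and r: "0 < r" "r < 1"
  shows "poly_approximable (lens \<alpha>) (lens_disc_map \<alpha> r)"
proof -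
  note S = compact_lens[OF \<alpha>]
  define L where "L = (\<lambda>z. Ln ((1 + of_real r * z) / (1 - of_real r * z)))"
  define E where "E = lens_half_plane_map \<alpha> r"
  have L: "poly_approximable (lens \<alpha>) L"
  proof -
    have "(\<lambda>w. Ln ((1 + w) / (1 - w))) holomorphic_on ball 0 1"
      by (intro holomorphic_intros) (use Re_cayley_pos in \<open>force elim!: nonpos_Reals_cases\<close>)+
    hence "poly_approximable (lens \<alpha>) (\<lambda>z. Ln ((1 + poly [:0, of_real r:] z) / (1 - poly [:0, of_real r:] z)))"
      using lens_subset_cball[OF \<alpha>] r
      by (intro poly_approximable_compose[OF S poly_approximable_poly, where h = "\<lambda>w. Ln ((1 + w) / (1 - w))" and r = r])
        (auto simp: norm_mult mult_left_le)
    thus ?thesis by (simp add: L_def mult.commute)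
  qed
  obtain B where B: "\<And>z. z \<in> lens \<alpha> \<Longrightarrow> cmod (L z) \<le> B"
    using poly_approximable_bounded[OF S L] by blast
  have E: "poly_approximable (lens \<alpha>) E"
  proof -
    have "poly_approximable (lens \<alpha>) (\<lambda>z. exp (of_real (pi / (2 * \<alpha>)) * L z))"
      by (rule poly_approximable_compose[OF S L, where c = 0 and r = B and R = "B + 1"
            and h = "\<lambda>w. exp (of_real (pi / (2 * \<alpha>)) * w)"])
        (auto intro!: holomorphic_intros simp: B)
    thus ?thesis by (simp add: E_def lens_half_plane_map_def[abs_def] L_def)
  qed
  obtain D where D: "\<And>z. z \<in> lens \<alpha> \<Longrightarrow> cmod (E z) \<le> D"
    using poly_approximable_bounded[OF S E] by blast
  \<comment> \<open>If \<open>\<bar>E z\<bar> \<le> D\<close> and \<open>Re (E z) \<ge> 0\<close>, then \<open>\<bar>E z - D\<^sup>2\<bar>\<^sup>2 \<le> D\<^sup>4 + D\<^sup>2 < (D\<^sup>2 + 1/2)\<^sup>2\<close>,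
    while the pole \<open>-1\<close> is at distance \<open>D\<^sup>2 + 1\<close> from the centre \<open>D\<^sup>2\<close>.\<close>
  have near: "cmod (E z - of_real (D\<^sup>2)) \<le> D\<^sup>2 + 1 / 2" if z: "z \<in> lens \<alpha>" for z
  proof (rule power2_le_imp_le)
    have Re: "Re (E z) \<ge> 0" unfolding E_def by (rule Re_lens_half_plane_map_nonneg[OF \<alpha> z r])
    have "(cmod (E z - of_real (D\<^sup>2)))\<^sup>2 = (cmod (E z))\<^sup>2 - 2 * D\<^sup>2 * Re (E z) + (D\<^sup>2)\<^sup>2"
      unfolding cmod_power2 by (simp add: power2_eq_square algebra_simps)
    also have "\<dots> \<le> D\<^sup>2 + (D\<^sup>2)\<^sup>2"
    proof -
      have "0 \<le> 2 * D\<^sup>2 * Re (E z)" using Re by simp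
      moreover have "(cmod (E z))\<^sup>2 \<le> D\<^sup>2" by (rule power_mono[OF D[OF z] norm_ge_zero])
      ultimately show ?thesis by linarith
    qed
    also have "\<dots> \<le> (D\<^sup>2 + 1 / 2)\<^sup>2" by (simp add: power2_eq_square algebra_simps)
    finally show "(cmod (E z - of_real (D\<^sup>2)))\<^sup>2 \<le> (D\<^sup>2 + 1 / 2)\<^sup>2" .
  qed simp
  have "w + 1 \<noteq> 0" if "w \<in> ball (of_real (D\<^sup>2)) (D\<^sup>2 + 1)" for w :: complex
  proof
    assume "w + 1 = 0"
    hence "w = of_real (- 1)" by (simp add: add_eq_0_iff2)
    hence "dist (of_real (D\<^sup>2)) w = \<bar>D\<^sup>2 - (- 1)\<bar>"
      by (simp only: dist_norm of_real_diff[symmetric] norm_of_real)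
    thus False using that by simp
  qed
  hence "(\<lambda>w. (w - 1) / (w + 1)) holomorphic_on ball (of_real (D\<^sup>2)) (D\<^sup>2 + 1)"
    by (intro holomorphic_intros) auto
  from poly_approximable_compose[OF S E this _ near]
  show ?thesis by (simp add: lens_disc_map_def[abs_def] E_def)
qed

lemma cball_subset_lens:
  assumes \<alpha>: "0 < \<alpha>" "\<alpha> \<le> pi / 2"
  obtains \<delta> where "\<delta> > 0" "cball 0 \<delta> \<subseteq> lens \<alpha>"
proof -
  note sc = sin_cos_lens_angle[OF \<alpha>]
  define \<delta> where "\<delta> = sin \<alpha> / (sin \<alpha> + 2 * cos \<alpha>)"
  have den: "sin \<alpha> + 2 * cos \<alpha> > 0" using sc by linarith
  have \<delta>: "\<delta> > 0" "\<delta> \<le> 1" using sc den by (simp_all add: \<delta>_def divide_le_eq)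
  have eq: "\<delta> * (sin \<alpha> + 2 * cos \<alpha>) = sin \<alpha>" using den by (simp add: \<delta>_def)
  have "z \<in> lens \<alpha>" if z: "cmod z \<le> \<delta>" for z
  proof -
    have "(cmod z)\<^sup>2 \<le> \<delta>\<^sup>2" using z by (intro power_mono) auto
    also have "\<delta>\<^sup>2 \<le> \<delta>" using \<delta> by (simp add: power2_eq_square)
    finally have "sin \<alpha> * (1 - \<delta>) \<le> sin \<alpha> * (1 - (cmod z)\<^sup>2)" using sc by (intro mult_left_mono) auto
    moreover have "2 * cos \<alpha> * \<bar>Im z\<bar> \<le> 2 * cos \<alpha> * \<delta>"
      using z abs_Im_le_cmod[of z] sc by (intro mult_left_mono) auto
    moreover have "sin \<alpha> * (1 - \<delta>) = 2 * cos \<alpha> * \<delta>" using eq by (simp add: algebra_simps)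
    ultimately have "lens_gap \<alpha> z \<ge> 0" by (simp add: lens_gap_def)
    thus ?thesis by (simp add: mem_lens_iff[OF \<alpha>])
  qed
  hence "cball 0 \<delta> \<subseteq> lens \<alpha>" by auto
  thus ?thesis using that \<delta>(1) by blast
qed

text \<open>The derivative exists at every point of the lens, which gives holomorphy near \<open>0\<close>; its value matters
  only at \<open>0\<close>, where the chain rule gives \<open>\<kappa> r\<close>.\<close>

lemma lens_disc_map_derivative:
  assumes \<alpha>: "0 < \<alpha>" "\<alpha> \<le> pi / 2" and r: "0 < r" "r < 1" and z: "z \<in> lens \<alpha>"
  obtains D where "(lens_disc_map \<alpha> r has_field_derivative D) (at z)"
    "z = 0 \<Longrightarrow> D = of_real (pi / (2 * \<alpha>) * r)"
proof -
  define q where "q = (\<lambda>z::complex. (1 + of_real r * z) / (1 - of_real r * z))"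
  define E where "E = lens_half_plane_map \<alpha> r"
  define \<kappa> where "\<kappa> = pi / (2 * \<alpha>)"
  have lt: "cmod (of_real r * z) < 1" by (rule cmod_scaled_lens_less_1[OF \<alpha> z r])
  hence ne: "1 - of_real r * z \<noteq> 0" by auto
  have Re: "Re (q z) > 0" unfolding q_def by (rule Re_cayley_pos[OF lt])
  hence slit: "q z \<notin> \<real>\<^sub>\<le>\<^sub>0" "q z \<noteq> 0" by (auto elim!: nonpos_Reals_cases)
  have q: "(q has_field_derivative 2 * of_real r / (1 - of_real r * z)\<^sup>2) (at z)"
    unfolding q_def using ne by (auto intro!: derivative_eq_intros simp: power2_eq_square algebra_simps)
  let ?E' = "E z * (of_real \<kappa> * (2 * of_real r / (1 - of_real r * z)\<^sup>2 / q z))"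
  have E_eq: "E = (\<lambda>z. exp (of_real \<kappa> * Ln (q z)))"
    by (simp add: E_def lens_half_plane_map_def[abs_def] \<kappa>_def q_def)
  have E: "(E has_field_derivative ?E') (at z)"
    unfolding E_eq using slit by (auto intro!: derivative_eq_intros q simp: divide_inverse mult_ac)
  have E1: "E z + 1 \<noteq> 0"
    unfolding E_def by (rule cmod_cayley_le_1(1)[OF Re_lens_half_plane_map_nonneg[OF \<alpha> z r]])
  have F_eq: "lens_disc_map \<alpha> r = (\<lambda>z. (E z - 1) / (E z + 1))"
    by (simp only: fun_eq_iff lens_disc_map_def E_def simp_thms)
  have "(lens_disc_map \<alpha> r has_field_derivative 2 * D / (E z + 1)\<^sup>2) (at z)"
    if D: "(E has_field_derivative D) (at z)" for D
    unfolding F_eq using E1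
    by (auto intro!: derivative_eq_intros D simp: power2_eq_square algebra_simps)
  note der = this[OF E]
  have "q 0 = 1" "E 0 = 1" by (simp_all add: q_def E_def lens_half_plane_map_def)
  hence "2 * ?E' / (E z + 1)\<^sup>2 = of_real (pi / (2 * \<alpha>) * r)" if "z = 0"
    unfolding that \<kappa>_def[symmetric] by simp
  with der show ?thesis by (rule that)
qed

text \<open>The scaled disc map has modulus at most \<open>1\<close> on the lens and derivative \<open>\<kappa> r\<close> at \<open>0\<close>. A polynomial
  within \<open>e\<close> of it on the lens has modulus at most \<open>1 + e\<close>, and by Cauchy's estimate on a disc of
  radius \<open>\<delta>\<close> inside the lens its derivative at \<open>0\<close> differs by at most \<open>e / \<delta>\<close>. Dividing by \<open>1 + e\<close>
  restores the bound \<open>1\<close>.\<close>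

lemma exists_lens_extremal_poly:
  assumes \<alpha>: "0 < \<alpha>" "\<alpha> \<le> pi / 2" and c: "0 \<le> c" "c < pi / (2 * \<alpha>)"
  obtains p where "\<And>z. z \<in> lens \<alpha> \<Longrightarrow> cmod (poly p z) \<le> 1" "c < cmod (poly (pderiv p) 0)"
proof -
  define \<kappa> where "\<kappa> = pi / (2 * \<alpha>)"
  have \<kappa>: "\<kappa> > 0" "c / \<kappa> < 1" using \<alpha> c by (simp_all add: \<kappa>_def field_simps)
  define r where "r = (c / \<kappa> + 1) / 2"
  have r: "0 < r" "r < 1" using \<kappa> c by (auto simp: r_def add_nonneg_pos)
  have "c / \<kappa> < r"
  proof -
    have "t < (t + 1) / 2" if "t < 1" for t :: real using that by simp
    thus ?thesis unfolding r_def using \<kappa>(2) by blast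
  qed
  hence \<kappa>r: "c < \<kappa> * r" using \<kappa> by (simp add: field_simps)
  define F where "F = lens_disc_map \<alpha> r"
  obtain \<delta> where \<delta>: "\<delta> > 0" "cball 0 \<delta> \<subseteq> lens \<alpha>" by (rule cball_subset_lens[OF \<alpha>])
  \<comment> \<open>The choice makes the loss \<open>e / \<delta> + c * e\<close> half of the margin \<open>\<kappa> * r - c\<close>.\<close>
  define e where "e = ((\<kappa> * r - c) / 2) / (1 / \<delta> + c)"
  have den: "1 / \<delta> + c > 0" using \<delta>(1) c by (simp add: add_pos_nonneg)
  have e: "e > 0" using \<kappa>r den by (simp add: e_def)
  have "e * (1 / \<delta> + c) = (\<kappa> * r - c) / 2"
    using den by (metis e_def less_irrefl nonzero_eq_divide_eq)
  hence e_le: "c * (1 + e) + e / \<delta> < \<kappa> * r" using \<kappa>r by (simp add: algebra_simps)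
  obtain p where p: "\<And>z. z \<in> lens \<alpha> \<Longrightarrow> cmod (F z - poly p z) < e"
    using poly_approximable_lens_disc_map[OF \<alpha> r] e unfolding poly_approximable_def F_def by blast
  define q where "q = smult (of_real (1 / (1 + e))) p"
  have "cmod (poly q z) \<le> 1" if z: "z \<in> lens \<alpha>" for z
  proof -
    have "cmod (F z) \<le> 1" unfolding F_def lens_disc_map_def
      by (rule cmod_cayley_le_1(2)[OF Re_lens_half_plane_map_nonneg[OF \<alpha> z r]])
    hence "cmod (poly p z) \<le> 1 + e"
      using p[OF z] norm_triangle_sub[of "poly p z" "F z"] by (simp add: norm_minus_commute)
    moreover have "cmod (poly q z) = cmod (poly p z) / (1 + e)"
      using e unfolding q_def poly_smult norm_mult norm_of_real by simp
    ultimately show ?thesis using e by simp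
  qed
  moreover have "c < cmod (poly (pderiv q) 0)"
  proof -
    have F': "\<exists>D. (F has_field_derivative D) (at z)" if "z \<in> cball 0 \<delta>" for z
      using lens_disc_map_derivative[OF \<alpha> r] \<delta>(2) that unfolding F_def by blast
    have hol: "(\<lambda>z. F z - poly p z) holomorphic_on cball 0 \<delta>"
    proof (intro holomorphic_intros)
      show "F holomorphic_on cball 0 \<delta>"
        using F' by (meson field_differentiable_at_within field_differentiable_def holomorphic_on_def)
    qed
    have "0 \<in> lens \<alpha>" using \<delta> by auto
    then obtain D where D: "(F has_field_derivative D) (at 0)" "D = of_real (\<kappa> * r)"
      using lens_disc_map_derivative[OF \<alpha> r, of 0] unfolding F_def \<kappa>_def by blast
    have "((\<lambda>z. F z - poly p z) has_field_derivative D - poly (pderiv p) 0) (at 0)"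
      by (intro derivative_intros D poly_DERIV)
    hence "cmod (D - poly (pderiv p) 0) = cmod ((deriv ^^ 1) (\<lambda>z. F z - poly p z) 0)"
      by (simp add: DERIV_imp_deriv)
    also have "\<dots> \<le> fact 1 * e / \<delta> ^ 1"
    proof (rule Cauchy_inequality[OF _ _ \<delta>(1)])
      show "(\<lambda>z. F z - poly p z) holomorphic_on ball 0 \<delta>"
        by (rule holomorphic_on_subset[OF hol]) auto
      show "continuous_on (cball 0 \<delta>) (\<lambda>z. F z - poly p z)"
        by (rule holomorphic_on_imp_continuous_on[OF hol])
      show "cmod (F z - poly p z) \<le> e" if "cmod (0 - z) = \<delta>" for z
        using p[of z] \<delta> that by (force simp: subset_iff)
    qed
    finally have "cmod D - e / \<delta> \<le> cmod (poly (pderiv p) 0)"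
      using norm_triangle_sub[of D "poly (pderiv p) 0"] by simp
    moreover have "cmod D = \<kappa> * r" unfolding D(2) norm_of_real using \<kappa> r by simp
    ultimately have "c * (1 + e) < cmod (poly (pderiv p) 0)" using e_le by linarith
    moreover have "cmod (poly (pderiv q) 0) = cmod (poly (pderiv p) 0) / (1 + e)"
      using e unfolding q_def pderiv_smult poly_smult norm_mult norm_of_real by simp
    ultimately show ?thesis using e by (simp add: less_divide_eq)
  qed
  ultimately show ?thesis by (rule that)
qed

section \<open>Sharpness\<close>

definition shift2 :: "complex \<Rightarrow> complex ^ 2 \<Rightarrow> complex ^ 2" where
  "shift2 s x = axis 1 (s * x $ 2)"

lemma norm_shift2: "norm (shift2 s x) = cmod s * cmod (x $ 2)"
proof -
  have "(norm (axis 1 w :: complex ^ 2))\<^sup>2 = (cmod w)\<^sup>2" for w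
    by (simp add: norm_vec_def L2_set_def UNIV_2 axis_def)
  thus ?thesis unfolding shift2_def by (metis norm_ge_zero norm_mult power2_eq_iff_nonneg)
qed

lemma square_zero_shift2: "square_zero (shift2 s)"
proof -
  have "norm (shift2 s x) \<le> norm x * cmod s" for x
    using mult_left_mono[OF Finite_Cartesian_Product.norm_nth_le[of x 2], of "cmod s"] by (simp add: norm_shift2 mult.commute)
  hence "bounded_linear (shift2 s)"
    by (intro bounded_linear_intro) (auto simp: shift2_def axis_def vec_eq_iff algebra_simps)
  thus ?thesis
    by (simp add: square_zero_def bounded_clinear_def shift2_def axis_def vec_eq_iff scaleC_vec_def
        scaleC_complex_def algebra_simps)
qed

text \<open>Here the eigenvalue is \<open>a = 0\<close>, where the gap is \<open>sin \<alpha>\<close>. As \<open>(I - M)\<inverse> = I + M\<close>, the Cayley transform of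
  \<open>M\<close> is \<open>I + 2 M\<close>, with \<open>\<mu> = 1\<close>.\<close>

lemma square_zero_mem_lens_class:
  assumes \<alpha>: "0 < \<alpha>" "\<alpha> \<le> pi / 2" and M: "square_zero (M :: 'h::chilbert_space \<Rightarrow> 'h)"
    and bound: "\<And>x. norm (M x) \<le> sin \<alpha> * norm x"
  shows "M \<in> lens_class \<alpha>"
proof -
  note sc = sin_cos_lens_angle[OF \<alpha>]
  have Mb: "bounded_clinear M" and MM: "\<And>x. M (M x) = 0" using M by (auto simp: square_zero_def)
  note lin = bounded_clinearD[OF Mb]
  have disc: "onorm (\<lambda>x. a *\<^sub>C x + M x) \<le> 1 / sin \<alpha>" if a: "cmod a = cot \<alpha>" for a
  proof (rule onorm_bound)
    fix x show "norm (a *\<^sub>C x + M x) \<le> 1 / sin \<alpha> * norm x"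
    proof (rule norm_shifted_square_zero_le[OF M _ _ bound])
      show "cmod a \<le> 1 / sin \<alpha>" using sc by (simp add: a cot_def divide_right_mono)
      show "sin \<alpha> * (1 / sin \<alpha>) \<le> (1 / sin \<alpha>)\<^sup>2 - (cmod a)\<^sup>2"
        using sc sin_cos_squared_add[of \<alpha>] by (simp add: a cot_def field_simps)
    qed (use sc in simp)
  qed (use sc in simp)
  have cot: "cot \<alpha> \<ge> 0" using sc by (simp add: cot_def)
  have inv1: "(x + M x) - M (x + M x) = x" for x by (simp add: lin MM)
  have minus: "M (- x) = - M x" for x using lin(3)[of 0 x] lin(4) by simp
  have "1 \<notin> Sp M"
  proof -
    define B where "B = (\<lambda>x. - (M x + 1 *\<^sub>C x))"
    have "bounded_clinear B" unfolding bounded_clinear_def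
    proof (intro conjI allI)
      show "bounded_linear B" unfolding B_def
        by (rule bounded_linear_minus[OF bounded_clinearD(1)[OF bounded_clinear_shift[OF Mb]]])
      show "B (c *\<^sub>C x) = c *\<^sub>C B x" for c x
        by (simp add: B_def lin scaleC_diff_right scaleC_minus_right)
    qed
    moreover have "B \<circ> shift_op M 1 = id" "shift_op M 1 \<circ> B = id"
      by (auto simp: B_def shift_op_def fun_eq_iff lin MM minus)
    ultimately show ?thesis by (auto simp: Sp_def)
  qed
  moreover have "(shift_op (cayley M) 1 ^^ 2) x = 0" for x
  proof -
    have "shift_op (cayley M) 1 y = M (2 *\<^sub>R y)" for y
      using cayley_apply[OF \<open>1 \<notin> Sp M\<close>, of "y + M y"] unfolding inv1
      by (simp add: shift_op_def lin MM scaleR_2)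
    thus ?thesis by (simp add: numeral_2_eq_2) (metis MM lin(1) lin(4) linear_simps(5) scaleR_zero_right)
  qed
  ultimately show ?thesis
    using disc[of "- (\<i> * complex_of_real (cot \<alpha>))"] disc[of "\<i> * complex_of_real (cot \<alpha>)"] Mb cot
    by (auto simp: lens_class_def scaleC_minus_left norm_mult add.commute)
qed

text \<open>For the 2 by 2 nilpotent matrix with entry \<open>sin \<alpha>\<close> and an almost extremal polynomial \<open>p\<close>, the
  off-diagonal entry of \<open>p(A)\<close> is \<open>p'(0) sin \<alpha>\<close>, which is as close to \<open>\<kappa> sin \<alpha>\<close> as desired.\<close>

lemma exists_ratio_greater:
  assumes \<alpha>: "0 < \<alpha>" "\<alpha> \<le> pi / 2" and c: "c < pi * sin \<alpha> / (2 * \<alpha>)"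
  obtains r where "r \<in> ratios \<alpha> (lens_class \<alpha> :: (complex ^ 2 \<Rightarrow> complex ^ 2) set)" "c < r"
proof -
  note sc = sin_cos_lens_angle[OF \<alpha>]
  have "max c 0 / sin \<alpha> < pi / (2 * \<alpha>)" using c sc \<alpha> by (simp add: field_simps max_def)
  moreover have nonneg: "max c 0 / sin \<alpha> \<ge> 0" using sc by simp
  ultimately obtain p where p: "\<And>z. z \<in> lens \<alpha> \<Longrightarrow> cmod (poly p z) \<le> 1"
      "max c 0 / sin \<alpha> < cmod (poly (pderiv p) 0)"
    using exists_lens_extremal_poly[OF \<alpha>] by blast
  define A where "A = shift2 (of_real (sin \<alpha>))"
  have M: "square_zero A" unfolding A_def by (rule square_zero_shift2)
  have A: "A \<in> lens_class \<alpha>"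
  proof (rule square_zero_mem_lens_class[OF \<alpha> M])
    show "norm (A x) \<le> sin \<alpha> * norm x" for x
      using sc mult_left_mono[OF Finite_Cartesian_Product.norm_nth_le[of x 2], of "sin \<alpha>"] by (simp add: A_def norm_shift2)
  qed
  have Ab: "bounded_clinear A" using M by (simp add: square_zero_def)
  define S where "S = (SUP z\<in>lens \<alpha>. cmod (poly p z))"
  have "p \<noteq> 0" using p(2) nonneg by auto
  define x where "x = (axis 2 1 :: complex ^ 2)"
  have x: "norm x = 1" by (simp add: x_def norm_vec_def L2_set_def UNIV_2 axis_def)
  have "poly_op p A x = poly p 0 *\<^sub>C x + poly (pderiv p) 0 *\<^sub>C A x"
    by (rule poly_op_shifted_square_zero[OF M Ab]) simp
  hence "poly_op p A x $ 1 = poly (pderiv p) 0 * of_real (sin \<alpha>)"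
    by (simp add: x_def A_def shift2_def scaleC_vec_def scaleC_complex_def axis_def)
  hence "cmod (poly (pderiv p) 0) * sin \<alpha> \<le> norm (poly_op p A x)"
    using Finite_Cartesian_Product.norm_nth_le[of "poly_op p A x" 1] sc by (simp add: norm_mult)
  also have "\<dots> \<le> onorm (poly_op p A)"
  proof -
    have "bounded_linear (poly_op p A)"
    proof -
      have eq: "poly_op p A = (\<lambda>x. poly (pderiv p) 0 *\<^sub>C A x + poly p 0 *\<^sub>C x)"
        using poly_op_shifted_square_zero[OF M Ab, of 0 p] by (auto simp: fun_eq_iff add.commute)
      have "bounded_clinear (\<lambda>x. poly (pderiv p) 0 *\<^sub>C A x)"
        using square_zero_scaleC[OF M] by (simp add: square_zero_def)
      from bounded_clinear_shift[OF this] show ?thesis unfolding eq by (rule bounded_clinearD(1))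
    qed
    from onorm[OF this, of x] show ?thesis using x by simp
  qed
  finally have "max c 0 < onorm (poly_op p A)"
    using p(2) sc by (simp add: divide_less_eq)
  moreover have "onorm (poly_op p A) \<le> pi * sin \<alpha> / (2 * \<alpha>) * S"
    by (rule onorm_bound)
      (use norm_poly_op_lens_class[OF \<alpha> A, of p] SUP_lens_nonneg[OF \<alpha>, of p] sc \<alpha> in
        \<open>auto simp: S_def simp del: times_divide_eq_left\<close>)
  \<comment> \<open>By the upper bound the maximum \<open>S\<close> of \<open>\<bar>p\<bar>\<close> cannot vanish, so the quotient is meaningful.\<close>
  ultimately have "S \<noteq> 0" by auto
  hence S: "0 < S" "S \<le> 1"
    using SUP_lens_nonneg[OF \<alpha>, of p] p(1) one_mem_lens[OF \<alpha>]
    by (auto simp: S_def intro!: cSUP_least)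
  have "onorm (poly_op p A) \<le> onorm (poly_op p A) / S"
    using S \<open>max c 0 < _\<close> by (simp add: le_divide_eq mult_left_le)
  with \<open>max c 0 < _\<close> have "c < onorm (poly_op p A) / S" by linarith
  moreover have "onorm (poly_op p A) / S
      \<in> ratios \<alpha> (lens_class \<alpha> :: (complex ^ 2 \<Rightarrow> complex ^ 2) set)"
    unfolding ratios_def S_def using A \<open>p \<noteq> 0\<close> by blast
  ultimately show ?thesis using that by blast
qed

lemma Sup_eq_if_approached:
  fixes C :: real
  assumes "\<And>r. r \<in> R \<Longrightarrow> r \<le> C" and "\<And>c. c < C \<Longrightarrow> \<exists>r\<in>R. c < r"
  shows "Sup R = C"
proof (rule cSup_eq_non_empty)
  show "R \<noteq> {}" using assms(2)[of "C - 1"] by auto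
  show "C \<le> y" if "\<And>r. r \<in> R \<Longrightarrow> r \<le> y" for y
    using assms(2)[of y] that by force
qed (rule assms(1))

theorem corollary1p2:
  fixes \<alpha> :: real
  assumes "0 < \<alpha>" and "\<alpha> \<le> pi / 2"
  shows "(\<forall>r \<in> ratios \<alpha> (lens_class \<alpha> :: ('h::chilbert_space \<Rightarrow> 'h) set).
             r \<le> pi * sin \<alpha> / (2 * \<alpha>))
       \<and> Sup (ratios \<alpha> (lens_class \<alpha> :: (complex^2 \<Rightarrow> complex^2) set))
           = pi * sin \<alpha> / (2 * \<alpha>)
       \<and> (\<forall>r \<in> ratios \<alpha> (sum_one ` (lens_class \<alpha> :: ('h \<Rightarrow> 'h) set)
                 :: ('h \<times> 'k::chilbert_space \<Rightarrow> 'h \<times> 'k) set).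
             r \<le> pi * sin \<alpha> / (2 * \<alpha>))
       \<and> Sup (ratios \<alpha> (lens_class \<alpha> :: (complex^2 \<Rightarrow> complex^2) set)
              \<union> ratios \<alpha> (sum_one ` (lens_class \<alpha> :: (complex^2 \<Rightarrow> complex^2) set)
                  :: ((complex^2) \<times> complex \<Rightarrow> (complex^2) \<times> complex) set))
           = pi * sin \<alpha> / (2 * \<alpha>)"
proof (intro conjI ballI)
  let ?C = "pi * sin \<alpha> / (2 * \<alpha>)"
  note \<alpha> = assms
  show "r \<le> ?C" if "r \<in> ratios \<alpha> (lens_class \<alpha> :: ('h \<Rightarrow> 'h) set)" for r
    using ratios_le_lens_constant[OF \<alpha> norm_poly_op_lens_class[OF \<alpha>] that] .
  show "r \<le> ?C" if "r \<in> ratios \<alpha> (sum_one ` (lens_class \<alpha> :: ('h \<Rightarrow> 'h) set)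
      :: ('h \<times> 'k \<Rightarrow> 'h \<times> 'k) set)" for r
    by (rule ratios_le_lens_constant[OF \<alpha> _ that]) (rule norm_poly_op_sum_one[OF \<alpha>])
  have le: "r \<le> ?C" if "r \<in> ratios \<alpha> (lens_class \<alpha> :: (complex^2 \<Rightarrow> complex^2) set)" for r
    using ratios_le_lens_constant[OF \<alpha> norm_poly_op_lens_class[OF \<alpha>] that] .
  have le_sum: "r \<le> ?C" if "r \<in> ratios \<alpha> (sum_one ` (lens_class \<alpha> :: (complex^2 \<Rightarrow> complex^2) set)
      :: ((complex^2) \<times> complex \<Rightarrow> (complex^2) \<times> complex) set)" for r
    by (rule ratios_le_lens_constant[OF \<alpha> _ that]) (rule norm_poly_op_sum_one[OF \<alpha>])
  have approached: "\<exists>r \<in> ratios \<alpha> (lens_class \<alpha> :: (complex^2 \<Rightarrow> complex^2) set). c < r"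
    if "c < ?C" for c
    using exists_ratio_greater[OF \<alpha> that] by blast
  show "Sup (ratios \<alpha> (lens_class \<alpha> :: (complex^2 \<Rightarrow> complex^2) set)) = ?C"
    by (rule Sup_eq_if_approached[OF le approached])
  show "Sup (ratios \<alpha> (lens_class \<alpha> :: (complex^2 \<Rightarrow> complex^2) set)
      \<union> ratios \<alpha> (sum_one ` (lens_class \<alpha> :: (complex^2 \<Rightarrow> complex^2) set)
          :: ((complex^2) \<times> complex \<Rightarrow> (complex^2) \<times> complex) set)) = ?C"
    by (rule Sup_eq_if_approached) (use le le_sum approached in blast)+
qed

end
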